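(* Let $\{x^k\}_{k\ge0}$ be generated by the algorithm ASFWGSC (described in the context) applied to $\min_{x\in\mathcal X}f(x)$, under the standing assumptions listed in the context, and put $h_k=f(x^k)-f^*$. Then for all $k\ge0$ $$h_{k}\leq (1-\theta)^{k/2}h_{0}\leq \exp\left(-\theta\frac{k}{2}\right)h_{0},$$ where $$\theta= \min\left\{\frac{1}{2},\frac{c_{1}(M_{f},\nu)\,\Omega}{2\operatorname{diam}(\mathcal X)},\frac{c_{2}(M_{f},\nu)\,\Omega^{2}\sigma_{f}}{8}\right\},\qquad \Omega=\frac{\Omega_{\mathcal X}}{|\mathcal U|}.$$
   Context: **Generalized self-concordance (GSC).** For $\nu\in[2,3]$ and $M_f\ge0$, $\mathcal F_{M_f,\nu}$ is the class of closed (lower semicontinuous) convex functions $f:\mathbb R^n\to(-\infty,+\infty]$ with $\operatorname{dom}f=\{f<\infty\}$ open and nonempty, $f$ three times continuously differentiable on $\operatorname{dom}f$, and $|\langle D^3f(x)[v]u,u\rangle|\le M_f\|u\|_x^2\|v\|_x^{\nu-2}\|v\|_2^{3-\nu}$ for all $x\in\operatorname{dom}f$, $u,v\in\mathbb R^n$, where $\|u\|_x=\sqrt{\langle\nabla^2f(x)u,u\rangle}$. **Standing assumptions.** $f\in\mathcal F_{M_f,\nu}$ with $\nu\in[2,3]$; $\mathcal X=\{x\in\mathbb R^n:\mathbf Bx\le b\}$ ($\mathbf B\in\mathbb R^{m\times n}$ with rows $\mathbf B_i$, $b\in\mathbb R^m$) is compact, with finite vertex set $\mathcal U$, and linear functions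 can be minimized over it efficiently and accurately; $\min_{x\in\mathcal X}f(x)$ has a solution $x^*$, $f^*=f(x^* )$; $\nabla^2f$ is continuous and positive definite on $\mathcal X\cap\operatorname{dom}f$; the oracle $s(x)\in\arg\min_{d\in\mathcal X}\langle\nabla f(x),d\rangle$ always returns a vertex, $s(x)\in\mathcal U$. **Geometric constant.** $I(u)=\{i:\mathbf B_iu=b_i\}$, $I(\mathcal U)=\bigcap_{u\in\mathcal U}I(u)$; $\zeta=\min\{b_i-\mathbf B_iu: u\in\mathcal U,\ i\in\{1,\dots,m\},\ b_i>\mathbf B_iu\}$, $\varphi=\max_{i\in\{1,\dots,m\}\setminus I(\mathcal U)}\|\mathbf B_i\|$, $\Omega_{\mathcal X}=\zeta/\varphi$. **The function $\omega_\nu$.** $\omega_2(t)=\frac{e^t-t-1}{t^2}$; $\omega_3(t)=\frac{-t-\ln(1-t)}{t^2}$; $\omega_\nu(t)=\frac{\nu-2}{4-\nu}\frac1t\left[\frac{\nu-2}{2(3-\nu)t}\left((1-t)^{\frac{2(3-\nu)}{2-\nu}}-1\right)-1\right]$ for $\nu\in(2,3)$ (extended by continuity at $t=0$; for $\nu>2$ the value is $+\infty$ for $t\ge1$). **Algorithm ASFWGSC.** Start at a vertex $x^0\in\mathcal U\cap\operatorname{dom}f$, with weights $\mu^0_{x^0}=1$, $\mu^0_u=0$ for $u\ne x^0$. Throughout $x^k=\sum_{u\in\mathcal U}\mu^k_uu$ with $\mu^k_u\ge0$, $\sum_u\mu^k_u=1$, and $U^k=\{u\in\mathcal U:\mu^k_u>0\}$.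 At iteration $k=0,1,\dots$: (1) $s^k=s(x^k)$ and $u^k\in\arg\max_{u\in U^k}\langle\nabla f(x^k),u\rangle$. (2) If $\langle\nabla f(x^k),s^k-x^k\rangle\le\langle\nabla f(x^k),x^k-u^k\rangle$ (forward step): $v^k=s^k-x^k$, $\bar t_k=1$. Otherwise (away step): $v^k=x^k-u^k$, $\bar t_k=\mu^k_{u^k}/(1-\mu^k_{u^k})$. (3) Put $e_k=\|v^k\|_{x^k}$, $\beta_k=\|v^k\|_2$, $\delta_k=\beta_k$ if $\nu=2$ and $\delta_k=\frac{\nu-2}2\beta_k^{3-\nu}e_k^{\nu-2}$ if $\nu\in(2,3]$, and take $\alpha_k\in\arg\min_{t\in[0,\bar t_k]}\left\{t\langle\nabla f(x^k),v^k\rangle+t^2e_k^2\,\omega_\nu(tM_f\delta_k)\right\}$; set $x^{k+1}=x^k+\alpha_kv^k$. (4) Weight update (vertex representation updating): after a forward step, $\mu^{k+1}_u=(1-\alpha_k)\mu^k_u$ for $u\ne s^k$ and $\mu^{k+1}_{s^k}=(1-\alpha_k)\mu^k_{s^k}+\alpha_k$; after an away step, $\mu^{k+1}_u=(1+\alpha_k)\mu^k_u$ for $u\ne u^k$ and $\mu^{k+1}_{u^k}=(1+\alpha_k)\mu^k_{u^k}-\alpha_k$ (so $u^k$ is removed exactly when $\alpha_k=\bar t_k$). **Constants.** $\mathcal S(x^0)=\{x\in\mathcal X\cap\operatorname{dom}f: f(x)\le f(x^0)\}$ (compact), $L_{\nabla f}=\max_{x\in\mathcal S(x^0)}\lambda_{\max}(\nabla^2f(x))$,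 $\sigma_f=\min_{x\in\mathcal S(x^0)}\lambda_{\min}(\nabla^2f(x))>0$, $D=\operatorname{diam}(\mathcal X)$. For $\nu\in(2,3)$: $\tilde\gamma_\nu=1+\frac{4-\nu}{2(3-\nu)}\left(1-2^{2(3-\nu)/(4-\nu)}\right)$ and $\mathsf b=\frac{2-\nu}{4-\nu}$. For $(M,\nu)\in(0,\infty)\times[2,3]$: $c_1(M,2)=\min\{\frac12,\frac{2\ln2-1}{MD}\}$; $c_1(M,\nu)=\min\{\frac12,\frac{\tilde\gamma_\nu}{D(\nu/2-1)ML_{\nabla f}^{(\nu-2)/2}}\}$ for $\nu\in(2,3)$; $c_1(M,3)=\min\{\frac12,\frac{2(1-\ln2)}{M\sqrt{L_{\nabla f}}D}\}$; $c_2(M,2)=\frac{2\ln2-1}{L_{\nabla f}D^2}$; $c_2(M,\nu)=\frac{-1}{\mathsf b}\frac{\tilde\gamma_\nu}{L_{\nabla f}D^2}$ for $\nu\in(2,3)$; $c_2(M,3)=\frac{2(1-\ln2)}{L_{\nabla f}D^2}$. *)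

theory Defs
  imports "HOL-Analysis.Analysis"
begin

section \<open>Extended-real-valued functions and their derivatives\<close>

definition edom :: "('a \<Rightarrow> ereal) \<Rightarrow> 'a set" where
  "edom f = {x. f x < \<infinity>}"

text \<open>The derivatives below are those of the real-valued function \<open>real_of_ereal \<circ> f\<close>; they are
  only used at points of the open set \<^term>\<open>edom f\<close>, where this function agrees locally with \<open>f\<close>.\<close>

definition grad :: "(real^'n \<Rightarrow> ereal) \<Rightarrow> real^'n \<Rightarrow> real^'n" where
  "grad f x = (THE g. GDERIV (\<lambda>y. real_of_ereal (f y)) x :> g)"

definition hess :: "(real^'n \<Rightarrow> ereal) \<Rightarrow> real^'n \<Rightarrow> real^'n^'n" where
  "hess f x = jacobian (grad f) (at x)"

text \<open>\<open>third_deriv f x v\<close> is the matrix of the linear map \<open>D\<^sup>3f(x)[v]\<close>, the derivative of the Hessian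
  in the direction \<open>v\<close>.\<close>

definition third_deriv :: "(real^'n \<Rightarrow> ereal) \<Rightarrow> real^'n \<Rightarrow> real^'n \<Rightarrow> real^'n^'n" where
  "third_deriv f x v = frechet_derivative (hess f) (at x) v"

definition C3_on_edom :: "(real^'n \<Rightarrow> ereal) \<Rightarrow> bool" where
  "C3_on_edom f \<longleftrightarrow>
     (\<forall>x\<in>edom f. (\<lambda>y. real_of_ereal (f y)) differentiable (at x) \<and>
                 grad f differentiable (at x) \<and> hess f differentiable (at x)) \<and>
     (\<forall>v. continuous_on (edom f) (\<lambda>x. third_deriv f x v))"

definition local_norm :: "(real^'n \<Rightarrow> ereal) \<Rightarrow> real^'n \<Rightarrow> real^'n \<Rightarrow> real" where
  "local_norm f x u = sqrt ((hess f x *v u) \<bullet> u)"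

section \<open>Generalized self-concordance\<close>

definition lower_semicont :: "('a::topological_space \<Rightarrow> ereal) \<Rightarrow> bool" where
  "lower_semicont f \<longleftrightarrow> (\<forall>x. f x \<le> Liminf (at x) f)"

definition econvex :: "('a::real_vector \<Rightarrow> ereal) \<Rightarrow> bool" where
  "econvex f \<longleftrightarrow> (\<forall>x y t. 0 < t \<and> t < 1 \<longrightarrow>
     f ((1 - t) *\<^sub>R x + t *\<^sub>R y) \<le> ereal (1 - t) * f x + ereal t * f y)"

text \<open>Real power with the convention \<open>0\<^sup>0 = 1\<close>, whereas \<open>0 powr 0 = 0\<close>.\<close>

definition rpow :: "real \<Rightarrow> real \<Rightarrow> real" where
  "rpow x a = (if a = 0 then 1 else x powr a)"

definition GSC :: "real \<Rightarrow> real \<Rightarrow> (real^'n \<Rightarrow> ereal) set" where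
  "GSC M \<nu> = {f. (\<forall>x. f x \<noteq> -\<infinity>) \<and> lower_semicont f \<and> econvex f \<and>
     open (edom f) \<and> edom f \<noteq> {} \<and> C3_on_edom f \<and>
     (\<forall>x\<in>edom f. \<forall>u v. \<bar>(third_deriv f x v *v u) \<bullet> u\<bar>
        \<le> M * (local_norm f x u)\<^sup>2 * rpow (local_norm f x v) (\<nu> - 2) * rpow (norm v) (3 - \<nu>))}"

section \<open>The polytope and its geometric constant\<close>

definition polyhedron_of :: "real^'n^'m \<Rightarrow> real^'m \<Rightarrow> (real^'n) set" where
  "polyhedron_of B b = {x. \<forall>i. B $ i \<bullet> x \<le> b $ i}"

definition vertices :: "(real^'n) set \<Rightarrow> (real^'n) set" where
  "vertices X = {u. u extreme_point_of X}"

definition active :: "real^'n^'m \<Rightarrow> real^'m \<Rightarrow> real^'n \<Rightarrow> 'm set" where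
  "active B b u = {i. B $ i \<bullet> u = b $ i}"

definition zeta :: "real^'n^'m \<Rightarrow> real^'m \<Rightarrow> real" where
  "zeta B b = Min {b $ i - B $ i \<bullet> u | u i. u \<in> vertices (polyhedron_of B b) \<and> b $ i > B $ i \<bullet> u}"

definition phi :: "real^'n^'m \<Rightarrow> real^'m \<Rightarrow> real" where
  "phi B b = Max ((\<lambda>i. norm (B $ i)) ` (UNIV - (\<Inter>u\<in>vertices (polyhedron_of B b). active B b u)))"

text \<open>The sets defining \<^const>\<open>zeta\<close> and \<^const>\<open>phi\<close> are empty only if the (compact, nonempty) polytope is a
  single point.\<close>

definition Omega_geom :: "real^'n^'m \<Rightarrow> real^'m \<Rightarrow> real" where
  "Omega_geom B b = zeta B b / phi B b"

section \<open>The function \<open>\<omega>\<^sub>\<nu>\<close> and the algorithm\<close>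

text \<open>Each branch has limit \<open>1/2\<close> as \<open>t \<rightarrow> 0\<close>.\<close>

definition omega :: "real \<Rightarrow> real \<Rightarrow> ereal" where
  "omega \<nu> t =
     (if t = 0 then ereal (1/2)
      else if \<nu> = 2 then ereal ((exp t - t - 1) / t\<^sup>2)
      else if t \<ge> 1 then \<infinity>
      else if \<nu> = 3 then ereal ((- t - ln (1 - t)) / t\<^sup>2)
      else ereal ((\<nu> - 2) / (4 - \<nu>) * (1 / t) *
        ((\<nu> - 2) / (2 * (3 - \<nu>) * t) * ((1 - t) powr (2 * (3 - \<nu>) / (2 - \<nu>)) - 1) - 1)))"

definition delta :: "real \<Rightarrow> real \<Rightarrow> real \<Rightarrow> real" where
  "delta \<nu> \<beta> e = (if \<nu> = 2 then \<beta> else (\<nu> - 2) / 2 * rpow \<beta> (3 - \<nu>) * rpow e (\<nu> - 2))"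

definition step_model :: "(real^'n \<Rightarrow> ereal) \<Rightarrow> real \<Rightarrow> real \<Rightarrow> real^'n \<Rightarrow> real^'n \<Rightarrow> real \<Rightarrow> ereal" where
  "step_model f M \<nu> x v t =
     (let e = local_norm f x v; \<beta> = norm v
      in ereal (t * (grad f x \<bullet> v)) + ereal (t\<^sup>2 * e\<^sup>2) * omega \<nu> (t * M * delta \<nu> \<beta> e))"

definition linear_oracle :: "(real^'n \<Rightarrow> ereal) \<Rightarrow> (real^'n) set \<Rightarrow> (real^'n \<Rightarrow> real^'n) \<Rightarrow> bool" where
  "linear_oracle f X s \<longleftrightarrow> (\<forall>x\<in>X \<inter> edom f.
     is_arg_min (\<lambda>d. grad f x \<bullet> d) (\<lambda>d. d \<in> X) (s x) \<and> s x \<in> vertices X)"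

definition support :: "(real^'n) set \<Rightarrow> (real^'n \<Rightarrow> real) \<Rightarrow> (real^'n) set" where
  "support X \<mu> = {w \<in> vertices X. \<mu> w > 0}"

definition forward_test :: "(real^'n \<Rightarrow> ereal) \<Rightarrow> real^'n \<Rightarrow> real^'n \<Rightarrow> real^'n \<Rightarrow> bool" where
  "forward_test f x s u \<longleftrightarrow> grad f x \<bullet> (s - x) \<le> grad f x \<bullet> (x - u)"

text \<open>One iteration from the iterate \<open>x\<close> with vertex weights \<open>\<mu>\<close>, using the vertices \<open>s\<close>, \<open>u\<close> and the
  step size \<open>\<alpha>\<close>, to the iterate \<open>x'\<close> with weights \<open>\<mu>'\<close>. In an away step \<open>\<mu> u < 1\<close>, so no
  division by zero occurs.\<close>

definition ASFW_step ::
  "(real^'n \<Rightarrow> ereal) \<Rightarrow> real \<Rightarrow> real \<Rightarrow> (real^'n) set \<Rightarrow>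
   real^'n \<Rightarrow> (real^'n \<Rightarrow> real) \<Rightarrow> real^'n \<Rightarrow> real^'n \<Rightarrow> real \<Rightarrow>
   real^'n \<Rightarrow> (real^'n \<Rightarrow> real) \<Rightarrow> bool" where
  "ASFW_step f M \<nu> X x \<mu> s u \<alpha> x' \<mu>' \<longleftrightarrow>
     (let fwd = forward_test f x s u;
          v = (if fwd then s - x else x - u);
          tmax = (if fwd then 1 else \<mu> u / (1 - \<mu> u))
      in is_arg_max (\<lambda>w. grad f x \<bullet> w) (\<lambda>w. w \<in> support X \<mu>) u \<and>
         is_arg_min (step_model f M \<nu> x v) (\<lambda>t. t \<in> {0..tmax}) \<alpha> \<and>
         x' = x + \<alpha> *\<^sub>R v \<and>
         (\<forall>w\<in>vertices X. \<mu>' w =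
            (if fwd then (1 - \<alpha>) * \<mu> w + (if w = s then \<alpha> else 0)
             else (1 + \<alpha>) * \<mu> w - (if w = u then \<alpha> else 0))))"

text \<open>The representation of every iterate as the convex combination of the vertices with
  weights \<open>\<mu> k\<close> is an invariant of the iteration and therefore not part of the definition.\<close>

definition ASFWGSC ::
  "(real^'n \<Rightarrow> ereal) \<Rightarrow> real \<Rightarrow> real \<Rightarrow> (real^'n) set \<Rightarrow> (real^'n \<Rightarrow> real^'n) \<Rightarrow>
   (nat \<Rightarrow> real^'n) \<Rightarrow> (nat \<Rightarrow> real^'n \<Rightarrow> real) \<Rightarrow> (nat \<Rightarrow> real^'n) \<Rightarrow> (nat \<Rightarrow> real) \<Rightarrow> bool" where
  "ASFWGSC f M \<nu> X s x \<mu> u \<alpha> \<longleftrightarrow>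
     x 0 \<in> vertices X \<inter> edom f \<and>
     (\<forall>w\<in>vertices X. \<mu> 0 w = (if w = x 0 then 1 else 0)) \<and>
     (\<forall>k. ASFW_step f M \<nu> X (x k) (\<mu> k) (s (x k)) (u k) (\<alpha> k) (x (Suc k)) (\<mu> (Suc k)))"

section \<open>Constants of the rate\<close>

definition eigenvalues :: "real^'n^'n \<Rightarrow> real set" where
  "eigenvalues A = {l. \<exists>v. v \<noteq> 0 \<and> A *v v = l *\<^sub>R v}"

definition lambda_max :: "real^'n^'n \<Rightarrow> real" where
  "lambda_max A = Max (eigenvalues A)"

definition lambda_min :: "real^'n^'n \<Rightarrow> real" where
  "lambda_min A = Min (eigenvalues A)"

definition sublevel :: "(real^'n \<Rightarrow> ereal) \<Rightarrow> (real^'n) set \<Rightarrow> real^'n \<Rightarrow> (real^'n) set" where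
  "sublevel f X x0 = {x \<in> X \<inter> edom f. f x \<le> f x0}"

definition L_grad :: "(real^'n \<Rightarrow> ereal) \<Rightarrow> (real^'n) set \<Rightarrow> real^'n \<Rightarrow> real" where
  "L_grad f X x0 = (SUP x\<in>sublevel f X x0. lambda_max (hess f x))"

definition sigma_min :: "(real^'n \<Rightarrow> ereal) \<Rightarrow> (real^'n) set \<Rightarrow> real^'n \<Rightarrow> real" where
  "sigma_min f X x0 = (INF x\<in>sublevel f X x0. lambda_min (hess f x))"

definition gamma_tilde :: "real \<Rightarrow> real" where
  "gamma_tilde \<nu> = 1 + (4 - \<nu>) / (2 * (3 - \<nu>)) * (1 - 2 powr (2 * (3 - \<nu>) / (4 - \<nu>)))"

text \<open>The value at \<open>M = 0\<close> is the limit \<open>min {1/2, \<infinity>}\<close> of the general formulas, which are meant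
  for \<open>M > 0\<close>.\<close>

definition c1 :: "real \<Rightarrow> real \<Rightarrow> real \<Rightarrow> real \<Rightarrow> real" where
  "c1 D L M \<nu> =
     (if M = 0 then 1/2
      else if \<nu> = 2 then min (1/2) ((2 * ln 2 - 1) / (M * D))
      else if \<nu> = 3 then min (1/2) (2 * (1 - ln 2) / (M * sqrt L * D))
      else min (1/2) (gamma_tilde \<nu> / (D * (\<nu> / 2 - 1) * M * L powr ((\<nu> - 2) / 2))))"

definition c2 :: "real \<Rightarrow> real \<Rightarrow> real \<Rightarrow> real" where
  "c2 D L \<nu> =
     (if \<nu> = 2 then (2 * ln 2 - 1) / (L * D\<^sup>2)
      else if \<nu> = 3 then 2 * (1 - ln 2) / (L * D\<^sup>2)
      else (- 1 / ((2 - \<nu>) / (4 - \<nu>))) * (gamma_tilde \<nu> / (L * D\<^sup>2)))"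

end

theory Submission
  imports Defs
begin

text \<open>
  Three estimates combine to a geometric decrease of the gap \<open>h\<^sub>k = f x\<^sub>k - f x\<^sup>*\<close> in every step that is
  not a drop step (an away step of maximal length), and drop steps make up at most half of all steps.

  \<^emph>\<open>The step model.\<close> Generalized self-concordance is a differential inequality for the second
  derivative \<open>q\<close> of \<open>f\<close> along a line, \<open>\<bar>q'\<bar> \<le> const * q powr (\<nu>/2)\<close>. Integrating it bounds \<open>q\<close> by an
  explicit growth function (\<open>hess_growth\<close>), and two more integrations show that the function minimized
  by the line search is an upper bound of \<open>f\<close> along the step (\<open>gsc_upper_bound\<close>); the blow-up of the
  closed function \<open>f\<close> at the boundary of its open domain keeps the step inside. Writing \<open>G\<close> for the
  negated slope, \<open>e\<close> for the local norm of the direction and \<open>m = M \<delta>\<close>, an unconstrained step decreases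
  the model by at least a multiple of \<open>G / m\<close> or of \<open>G\<^sup>2 / e\<^sup>2\<close> (\<open>model_decrease\<close>). It is enough to try
  one explicit step length, because \<open>\<omega>\<^sub>\<nu>\<close> is nondecreasing. The bound on the step length is harmless
  unless the step is a drop step: a full forward step already decreases the model by \<open>G / 2\<close>, and a
  minimizer inside the interval is an unconstrained one by convexity of the model. Bounding \<open>e\<close> by the
  largest eigenvalue on the initial sublevel set turns the two multiples into \<open>c1\<close> and \<open>c2 / 2\<close>.

  \<^emph>\<open>The pairwise gap.\<close> The chosen direction satisfies \<open>2 G \<ge> \<langle>\<nabla>f x\<^sub>k, u\<^sub>k - s\<^sub>k\<rangle>\<close>. For any \<open>y\<close> in the
  polytope, \<open>y - x\<^sub>k\<close> can be written by moving weight from vertices \<open>w\<close> in the support of \<open>x\<^sub>k\<close> to one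
  point \<open>z\<close> of the polytope; if no smaller amount of weight can be moved, each such \<open>w\<close> has slack
  at least \<open>\<zeta>\<close> in some constraint that is active at \<open>z\<close>, which bounds the moved weight by a multiple of
  the distance from \<open>x\<^sub>k\<close> to \<open>y\<close> (\<open>irreducible_exchange\<close>, \<open>pairwise_gap_bound\<close>). Hence \<open>G\<close> is at least
  \<open>\<Omega> / 2\<close> times the slope of \<open>f\<close> at \<open>x\<^sub>k\<close> towards \<open>x\<^sup>*\<close>.

  \<^emph>\<open>Strong convexity.\<close> On the initial sublevel set the Hessian is bounded below by \<open>\<sigma>\<close>, so this slope
  is at least \<open>h\<^sub>k / D\<close> and its square is at least \<open>2 \<sigma> h\<^sub>k\<close> (\<open>strong_convexity_on_sublevel\<close>). Inserting
  both bounds gives \<open>h\<^sub>k\<^sub>+\<^sub>1 \<le> (1 - \<theta>) h\<^sub>k\<close> for every step that is not a drop step (\<open>contraction\<close>).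

  A drop step removes a vertex from the support, a forward step adds at most one, and the support
  starts with one vertex and never becomes empty. Hence at least \<open>k / 2\<close> of the first \<open>k\<close> steps are
  not drop steps (\<open>half_of_steps_good\<close>).
\<close>

section \<open>The growth function and the step model\<close>

text \<open>The comparison principle behind the second-order estimates below: it is applied to differences
  of two functions whose second derivatives are ordered.\<close>

lemma second_order_bound:
  fixes F F1 F2 :: "real \<Rightarrow> real"
  assumes "0 \<le> t"
    and "\<And>s. 0 \<le> s \<Longrightarrow> s \<le> t \<Longrightarrow> (F has_real_derivative F1 s) (at s)"
    and "\<And>s. 0 \<le> s \<Longrightarrow> s \<le> t \<Longrightarrow> (F1 has_real_derivative F2 s) (at s)"
    and "\<And>s. 0 \<le> s \<Longrightarrow> s \<le> t \<Longrightarrow> 0 \<le> F2 s"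
  shows "F 0 + t * F1 0 \<le> F t"
  using f''_imp_f'[of "{0..t}" F F1 F2 0 t] assms by (auto simp: algebra_simps)

text \<open>The solution with value \<open>1\<close> at \<open>0\<close> of the extremal equation \<open>q' = 2 / (\<nu> - 2) * q powr (\<nu> / 2)\<close>, and of
  \<open>q' = q\<close> for \<open>\<nu> = 2\<close>. Its antiderivatives \<open>growth_int\<close> and \<open>growth_int2\<close> vanish at \<open>0\<close>, and
  \<open>growth_int2 \<nu> r\<close> is \<open>r\<^sup>2 \<omega>\<^sub>\<nu>(r)\<close>.\<close>

definition growth :: "real \<Rightarrow> real \<Rightarrow> real" where
  "growth \<nu> r = (if \<nu> = 2 then exp r else (1 - r) powr (2 / (2 - \<nu>)))"

definition growth_int :: "real \<Rightarrow> real \<Rightarrow> real" where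
  "growth_int \<nu> r = (if \<nu> = 2 then exp r - 1
     else (\<nu> - 2) / (4 - \<nu>) * ((1 - r) powr ((4 - \<nu>) / (2 - \<nu>)) - 1))"

definition growth_int2 :: "real \<Rightarrow> real \<Rightarrow> real" where
  "growth_int2 \<nu> r = (if \<nu> = 2 then exp r - r - 1
     else if \<nu> = 3 then - r - ln (1 - r)
     else (\<nu> - 2) / (4 - \<nu>) *
       ((\<nu> - 2) / (2 * (3 - \<nu>)) * ((1 - r) powr (2 * (3 - \<nu>) / (2 - \<nu>)) - 1) - r))"

text \<open>The range in which the solution has not blown up; for positive \<open>r\<close> this is the range in
  which \<open>\<omega>\<^sub>\<nu>(r)\<close> is finite.\<close>

definition growth_dom :: "real \<Rightarrow> real \<Rightarrow> bool" where
  "growth_dom \<nu> r \<longleftrightarrow> \<nu> = 2 \<or> r < 1"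

lemma growth_zero [simp]: "growth \<nu> 0 = 1" "growth_int \<nu> 0 = 0" "growth_int2 \<nu> 0 = 0"
  by (simp_all add: growth_def growth_int_def growth_int2_def)

lemma growth_mono:
  assumes "2 \<le> \<nu>" "growth_dom \<nu> s" "r \<le> s"
  shows "growth \<nu> r \<le> growth \<nu> s"
proof (cases "\<nu> = 2")
  case False
  then have "2 / (2 - \<nu>) \<le> 0"
    using assms by (simp add: divide_le_0_iff)
  then show ?thesis
    using assms False powr_mono2'[of "2 / (2 - \<nu>)" "1 - s" "1 - r"] by (simp add: growth_def growth_dom_def)
qed (use assms in \<open>simp add: growth_def\<close>)

lemma growth_nonneg: "0 \<le> growth \<nu> r"
  by (simp add: growth_def)

lemma DERIV_growth_int:
  assumes "2 \<le> \<nu>" "\<nu> \<le> 3" "growth_dom \<nu> r"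
  shows "(growth_int \<nu> has_real_derivative growth \<nu> r) (at r)"
proof (cases "\<nu> = 2")
  case True
  show ?thesis
    unfolding growth_int_def[abs_def] growth_def using True by (auto intro!: derivative_eq_intros)
next
  case False
  have e: "(4 - \<nu>) / (2 - \<nu>) - 1 = 2 / (2 - \<nu>)" using False by (simp add: field_simps)
  have "r < 1" using assms False by (simp add: growth_dom_def)
  then have "((\<lambda>r. (\<nu> - 2) / (4 - \<nu>) * ((1 - r) powr ((4 - \<nu>) / (2 - \<nu>)) - 1)) has_real_derivative
      (\<nu> - 2) / (4 - \<nu>) * ((4 - \<nu>) / (2 - \<nu>) * (1 - r) powr ((4 - \<nu>) / (2 - \<nu>) - 1) * (0 - 1))) (at r)"
    by (intro DERIV_cmult) (auto intro!: derivative_eq_intros simp: field_simps)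
  also have "(\<nu> - 2) / (4 - \<nu>) * ((4 - \<nu>) / (2 - \<nu>) * (1 - r) powr ((4 - \<nu>) / (2 - \<nu>) - 1) * (0 - 1))
      = growth \<nu> r"
    using False assms unfolding e growth_def by (simp add: divide_simps) (simp add: algebra_simps)
  finally show ?thesis
    unfolding growth_int_def[abs_def] using False by simp
qed

lemma DERIV_growth_int2:
  assumes "2 \<le> \<nu>" "\<nu> \<le> 3" "growth_dom \<nu> r"
  shows "(growth_int2 \<nu> has_real_derivative growth_int \<nu> r) (at r)"
proof -
  consider "\<nu> = 2" | "\<nu> = 3" | "2 < \<nu>" "\<nu> < 3" using assms by linarith
  then show ?thesis
  proof cases
    case 1
    then show ?thesis
      unfolding growth_int2_def[abs_def] growth_int_def by (auto intro!: derivative_eq_intros)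
  next
    case 2
    then have "r < 1" using assms by (simp add: growth_dom_def)
    then have "((\<lambda>r. - r - ln (1 - r)) has_real_derivative (1 / (1 - r) - 1)) (at r)"
      by (auto intro!: derivative_eq_intros)
    moreover have "growth_int 3 r = 1 / (1 - r) - 1"
      using \<open>r < 1\<close> by (simp add: growth_int_def powr_minus divide_inverse)
    ultimately show ?thesis
      using 2 unfolding growth_int2_def[abs_def] by simp
  next
    case 3
    have e: "2 * (3 - \<nu>) / (2 - \<nu>) - 1 = (4 - \<nu>) / (2 - \<nu>)" using 3 by (simp add: field_simps)
    have "r < 1" using assms 3 by (simp add: growth_dom_def)
    then have "((\<lambda>r. (\<nu> - 2) / (4 - \<nu>) *
       ((\<nu> - 2) / (2 * (3 - \<nu>)) * ((1 - r) powr (2 * (3 - \<nu>) / (2 - \<nu>)) - 1) - r)) has_real_derivative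
        (\<nu> - 2) / (4 - \<nu>) * ((\<nu> - 2) / (2 * (3 - \<nu>)) *
          (2 * (3 - \<nu>) / (2 - \<nu>) * (1 - r) powr (2 * (3 - \<nu>) / (2 - \<nu>) - 1) * (0 - 1)) - 1)) (at r)"
      by (intro DERIV_cmult DERIV_diff DERIV_ident) (auto intro!: derivative_eq_intros simp: field_simps)
    also have "(\<nu> - 2) / (4 - \<nu>) * ((\<nu> - 2) / (2 * (3 - \<nu>)) *
          (2 * (3 - \<nu>) / (2 - \<nu>) * (1 - r) powr (2 * (3 - \<nu>) / (2 - \<nu>) - 1) * (0 - 1)) - 1) = growth_int \<nu> r"
      using 3 unfolding e growth_int_def by (simp add: divide_simps) (simp add: algebra_simps)
    finally show ?thesis
      unfolding growth_int2_def[abs_def] using 3 by simp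
  qed
qed

lemma growth_dom_le: "growth_dom \<nu> s \<Longrightarrow> r \<le> s \<Longrightarrow> growth_dom \<nu> r"
  by (auto simp: growth_dom_def)

definition omega_real :: "real \<Rightarrow> real \<Rightarrow> real" where
  "omega_real \<nu> r = (if r = 0 then 1/2 else growth_int2 \<nu> r / r\<^sup>2)"

lemma omega_eq_ereal:
  assumes "2 \<le> \<nu>" "\<nu> \<le> 3"
  shows "omega \<nu> r = (if r = 0 \<or> growth_dom \<nu> r then ereal (omega_real \<nu> r) else \<infinity>)"
proof -
  have "(\<nu> - 2) / (4 - \<nu>) * (1 / r) * ((\<nu> - 2) / (2 * (3 - \<nu>) * r) * (p - 1) - 1)
      = (\<nu> - 2) / (4 - \<nu>) * ((\<nu> - 2) / (2 * (3 - \<nu>)) * (p - 1) - r) / r\<^sup>2"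
    if "r \<noteq> 0" "\<nu> \<noteq> 3" for p
    using that assms by (simp add: field_simps power2_eq_square)
  then show ?thesis
    unfolding omega_def omega_real_def growth_int2_def growth_dom_def by auto
qed

text \<open>Since \<open>growth\<close> is nondecreasing, the second derivative in \<open>r\<close> of the right-hand side dominates that
  of the left-hand side. Divided by \<open>l\<^sup>2 r\<^sup>2\<close>, the inequality says that \<open>\<omega>\<^sub>\<nu>\<close> is nondecreasing.\<close>

lemma growth_int2_scale:
  assumes "2 \<le> \<nu>" "\<nu> \<le> 3" "0 \<le> r" "growth_dom \<nu> r" "0 \<le> l" "l \<le> 1"
  shows "growth_int2 \<nu> (l * r) \<le> l\<^sup>2 * growth_int2 \<nu> r"
proof -
  have le: "l * s \<le> s" if "0 \<le> s" for s
    using that assms by (simp add: mult_left_le_one_le)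
  have dom: "growth_dom \<nu> s" "growth_dom \<nu> (l * s)" if "0 \<le> s" "s \<le> r" for s
    using growth_dom_le[OF assms(4)] that le[of s] by auto
  have "(\<lambda>s. l\<^sup>2 * growth_int2 \<nu> s - growth_int2 \<nu> (l * s)) 0 + r * (\<lambda>s. l\<^sup>2 * growth_int \<nu> s - growth_int \<nu> (l * s) * l) 0
      \<le> (\<lambda>s. l\<^sup>2 * growth_int2 \<nu> s - growth_int2 \<nu> (l * s)) r"
  proof (rule second_order_bound[where ?F2.0 = "\<lambda>s. l\<^sup>2 * growth \<nu> s - (growth \<nu> (l * s) * l) * l"])
    fix s assume s: "0 \<le> s" "s \<le> r"
    show "((\<lambda>s. l\<^sup>2 * growth_int2 \<nu> s - growth_int2 \<nu> (l * s)) has_real_derivative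
        l\<^sup>2 * growth_int \<nu> s - growth_int \<nu> (l * s) * l) (at s)"
      by (intro DERIV_diff DERIV_cmult DERIV_growth_int2 assms(1,2) dom s
          DERIV_chain'[where g = "growth_int2 \<nu>"]) (auto intro!: derivative_eq_intros)
    show "((\<lambda>s. l\<^sup>2 * growth_int \<nu> s - growth_int \<nu> (l * s) * l) has_real_derivative
        l\<^sup>2 * growth \<nu> s - growth \<nu> (l * s) * l * l) (at s)"
      by (intro DERIV_diff DERIV_cmult DERIV_cmult_right DERIV_growth_int assms(1,2) dom s
          DERIV_chain'[where g = "growth_int \<nu>"]) (auto intro!: derivative_eq_intros)
    have "l\<^sup>2 * growth \<nu> (l * s) \<le> l\<^sup>2 * growth \<nu> s"
      by (intro mult_left_mono growth_mono assms dom s le) auto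
    then show "0 \<le> l\<^sup>2 * growth \<nu> s - growth \<nu> (l * s) * l * l"
      by (simp add: power2_eq_square algebra_simps)
  qed (use assms in auto)
  then show ?thesis by simp
qed

text \<open>The second derivative \<open>growth\<close> is at least \<open>1\<close>, so \<open>\<omega>\<^sub>\<nu>\<close> is at least its value \<open>1/2\<close> at \<open>0\<close>.\<close>

lemma growth_int2_ge:
  assumes "2 \<le> \<nu>" "\<nu> \<le> 3" "0 \<le> r" "growth_dom \<nu> r"
  shows "r\<^sup>2 / 2 \<le> growth_int2 \<nu> r"
proof -
  have "(\<lambda>s. growth_int2 \<nu> s - s\<^sup>2 / 2) 0 + r * (\<lambda>s. growth_int \<nu> s - s) 0 \<le> (\<lambda>s. growth_int2 \<nu> s - s\<^sup>2 / 2) r"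
  proof (rule second_order_bound[where ?F2.0 = "\<lambda>s. growth \<nu> s - 1"])
    fix s assume s: "0 \<le> s" "s \<le> r"
    note d = growth_dom_le[OF assms(4) s(2)]
    show "((\<lambda>s. growth_int2 \<nu> s - s\<^sup>2 / 2) has_real_derivative growth_int \<nu> s - s) (at s)"
      by (intro DERIV_diff DERIV_growth_int2 assms d) (auto intro!: derivative_eq_intros)
    show "((\<lambda>s. growth_int \<nu> s - s) has_real_derivative growth \<nu> s - 1) (at s)"
      by (intro DERIV_diff DERIV_growth_int assms d DERIV_ident)
    show "0 \<le> growth \<nu> s - 1"
      using growth_mono[OF assms(1) d s(1)] by simp
  qed (use assms in auto)
  then show ?thesis by simp
qed

text \<open>The derivative \<open>growth_int\<close> is convex and vanishes at \<open>0\<close>, so the area under its graph is at most that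
  of the triangle under the chord.\<close>

lemma growth_int2_le_half:
  assumes "2 \<le> \<nu>" "\<nu> \<le> 3" "0 \<le> r" "growth_dom \<nu> r"
  shows "growth_int2 \<nu> r \<le> r * growth_int \<nu> r / 2"
proof -
  have d: "growth_dom \<nu> s" if "s \<le> r" for s
    using growth_dom_le[OF assms(4)] that by blast
  have ki: "growth_int \<nu> s \<le> s * growth \<nu> s" if "0 \<le> s" "s \<le> r" for s
  proof (cases "s = 0")
    case False
    have "\<exists>z>0. z < s \<and> growth_int \<nu> s - growth_int \<nu> 0 = (s - 0) * growth \<nu> z"
      by (intro MVT2 DERIV_growth_int assms d) (use False that in auto)
    then obtain z where z: "0 < z" "z < s" "growth_int \<nu> s = s * growth \<nu> z" by auto
    have "growth \<nu> z \<le> growth \<nu> s" using z that by (intro growth_mono assms d) auto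
    then show ?thesis using z that by (simp add: mult_left_mono)
  qed simp
  have "\<exists>z>0. z < r \<and> (\<lambda>s. s * growth_int \<nu> s - 2 * growth_int2 \<nu> s) r - (\<lambda>s. s * growth_int \<nu> s - 2 * growth_int2 \<nu> s) 0
      = (r - 0) * (\<lambda>s. s * growth \<nu> s - growth_int \<nu> s) z" if "0 < r"
  proof (rule MVT2[OF that])
    fix s assume s: "0 \<le> s" "s \<le> r"
    have "((\<lambda>s. s * growth_int \<nu> s - 2 * growth_int2 \<nu> s) has_real_derivative
        (1 * growth_int \<nu> s + growth \<nu> s * s) - 2 * growth_int \<nu> s) (at s)"
      by (intro DERIV_diff DERIV_mult DERIV_cmult DERIV_ident DERIV_growth_int DERIV_growth_int2 assms d s)
    then show "((\<lambda>s. s * growth_int \<nu> s - 2 * growth_int2 \<nu> s) has_real_derivative s * growth \<nu> s - growth_int \<nu> s) (at s)"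
      by (simp add: algebra_simps)
  qed
  then have "0 \<le> r * growth_int \<nu> r - 2 * growth_int2 \<nu> r" if r: "0 < r"
    using r
  proof (elim meta_impE exE conjE)
    fix z assume "0 < z" "z < r" and eq: "r * growth_int \<nu> r - 2 * growth_int2 \<nu> r -
        (0 * growth_int \<nu> 0 - 2 * growth_int2 \<nu> 0) = (r - 0) * (z * growth \<nu> z - growth_int \<nu> z)"
    then show ?thesis
      using ki[of z] r by simp
  qed
  then show ?thesis
    using assms(3) by (cases "r = 0") auto
qed

lemma omega_real_mono:
  assumes "2 \<le> \<nu>" "\<nu> \<le> 3" "0 \<le> r" "r \<le> R" "0 < R" "growth_dom \<nu> R"
  shows "omega_real \<nu> r \<le> omega_real \<nu> R"
proof (cases "r = 0")
  case True
  then show ?thesis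
    using growth_int2_ge[of \<nu> R] assms by (simp add: omega_real_def field_simps)
next
  case False
  have "growth_int2 \<nu> r \<le> (r / R)\<^sup>2 * growth_int2 \<nu> R"
    using growth_int2_scale[of \<nu> R "r / R"] assms by simp
  then show ?thesis
    using False assms by (simp add: omega_real_def field_simps)
qed

text \<open>The quadratic part of the step model for a direction of unit local norm. Where it is finite, its
  second derivative in \<open>t\<close> is \<open>growth \<nu> (t * m)\<close>, also for \<open>m = 0\<close>.\<close>

definition gsc_quad :: "real \<Rightarrow> real \<Rightarrow> real \<Rightarrow> real" where
  "gsc_quad \<nu> m t = t\<^sup>2 * omega_real \<nu> (t * m)"

definition gsc_quad' :: "real \<Rightarrow> real \<Rightarrow> real \<Rightarrow> real" where
  "gsc_quad' \<nu> m t = (if m = 0 then t else growth_int \<nu> (t * m) / m)"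

lemma gsc_quad_eq: "gsc_quad \<nu> m t = (if m = 0 then t\<^sup>2 / 2 else growth_int2 \<nu> (t * m) / m\<^sup>2)"
  by (auto simp: gsc_quad_def omega_real_def power_mult_distrib)

lemma gsc_quad_zero [simp]: "gsc_quad \<nu> m 0 = 0" "gsc_quad' \<nu> m 0 = 0"
  by (simp_all add: gsc_quad_def gsc_quad'_def)

lemma DERIV_gsc_quad:
  assumes "2 \<le> \<nu>" "\<nu> \<le> 3" "growth_dom \<nu> (t * m)"
  shows "(gsc_quad \<nu> m has_real_derivative gsc_quad' \<nu> m t) (at t)"
proof (cases "m = 0")
  case False
  have "((\<lambda>t. growth_int2 \<nu> (t * m) / m\<^sup>2) has_real_derivative (growth_int \<nu> (t * m) * m) / m\<^sup>2) (at t)"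
    by (intro DERIV_cdivide DERIV_chain'[where g = "growth_int2 \<nu>"] DERIV_growth_int2 assms)
       (auto intro!: derivative_eq_intros)
  then show ?thesis
    using False unfolding gsc_quad_eq[abs_def] gsc_quad'_def by (simp add: power2_eq_square)
qed (auto simp: gsc_quad_eq[abs_def] gsc_quad'_def intro!: derivative_eq_intros)

lemma DERIV_gsc_quad':
  assumes "2 \<le> \<nu>" "\<nu> \<le> 3" "growth_dom \<nu> (t * m)"
  shows "(gsc_quad' \<nu> m has_real_derivative growth \<nu> (t * m)) (at t)"
proof (cases "m = 0")
  case False
  have "((\<lambda>t. growth_int \<nu> (t * m) / m) has_real_derivative (growth \<nu> (t * m) * m) / m) (at t)"
    by (intro DERIV_cdivide DERIV_chain'[where g = "growth_int \<nu>"] DERIV_growth_int assms)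
       (auto intro!: derivative_eq_intros)
  then show ?thesis
    using False unfolding gsc_quad'_def[abs_def] by simp
qed (auto simp: gsc_quad'_def[abs_def])

lemma convex_on_gsc_quad:
  assumes "2 \<le> \<nu>" "\<nu> \<le> 3" "0 \<le> m"
  shows "convex_on {t. 0 \<le> t \<and> growth_dom \<nu> (t * m)} (gsc_quad \<nu> m)"
proof (rule f''_ge0_imp_convex)
  have "convex {t. growth_dom \<nu> (t * m)}"
  proof (cases "\<nu> = 2")
    case False
    have "{t. growth_dom \<nu> (t * m)} = {t. m * t < 1}"
      using False by (auto simp: growth_dom_def mult.commute)
    then show ?thesis
      using convex_halfspace_lt[of m 1] by simp
  qed (simp add: growth_dom_def)
  then have "convex ({0..} \<inter> {t. growth_dom \<nu> (t * m)})"
    by (intro convex_Int) auto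
  then show "convex {t. 0 \<le> t \<and> growth_dom \<nu> (t * m)}"
    by (simp add: Int_def)
  fix t assume "t \<in> {t. 0 \<le> t \<and> growth_dom \<nu> (t * m)}"
  then show "(gsc_quad \<nu> m has_real_derivative gsc_quad' \<nu> m t) (at t)"
    "(gsc_quad' \<nu> m has_real_derivative growth \<nu> (t * m)) (at t)"
    using assms by (auto intro: DERIV_gsc_quad DERIV_gsc_quad')
qed (rule growth_nonneg)

section \<open>Decrease of the step model\<close>

text \<open>The largest value of \<open>r a - growth_int2 \<nu> r\<close> over \<open>r\<close>, for one suitable slope \<open>a\<close>, divided by \<open>a\<close> here and
  by \<open>a\<^sup>2\<close> in \<open>rate_quad\<close>. The slope is \<open>1\<close> for \<open>\<nu> = 2\<close> and \<open>\<nu> = 3\<close>, and \<open>(\<nu> - 2) / (4 - \<nu>)\<close> in between.\<close>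

definition rate_lin :: "real \<Rightarrow> real" where
  "rate_lin \<nu> = (if \<nu> = 2 then 2 * ln 2 - 1 else if \<nu> = 3 then 1 - ln 2 else gamma_tilde \<nu>)"

definition rate_quad :: "real \<Rightarrow> real" where
  "rate_quad \<nu> = (if \<nu> = 2 then 2 * ln 2 - 1 else if \<nu> = 3 then 1 - ln 2
     else (4 - \<nu>) / (\<nu> - 2) * gamma_tilde \<nu>)"

text \<open>At a maximizer \<open>r\<close> of \<open>r a - growth_int2 \<nu> r\<close> the slope \<open>a\<close> equals \<open>growth_int \<nu> r\<close>. The maximizers are
  \<open>ln 2\<close>, \<open>1 / 2\<close> and \<open>1 - 2 powr ((2 - \<nu>) / (4 - \<nu>))\<close>; in each case the closed forms
  evaluate to elementary numbers.\<close>

lemma conjugate_value: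
  assumes "2 \<le> \<nu>" "\<nu> \<le> 3"
  obtains r where "0 < r" "growth_dom \<nu> r" "0 < growth_int \<nu> r"
    "r * growth_int \<nu> r - growth_int2 \<nu> r = rate_lin \<nu> * growth_int \<nu> r"
    "rate_lin \<nu> = rate_quad \<nu> * growth_int \<nu> r"
proof -
  consider "\<nu> = 2" | "\<nu> = 3" | "2 < \<nu>" "\<nu> < 3" using assms by linarith
  then show ?thesis
  proof cases
    case 1
    then show ?thesis
      by (intro that[of "ln 2"]) (simp_all add: growth_dom_def growth_int_def growth_int2_def rate_lin_def rate_quad_def)
  next
    case 2
    have "(1 / 2 :: real) powr (-1) = 2" by (simp add: powr_minus)
    moreover have "ln (1 / 2 :: real) = - ln 2" by (simp add: ln_div)
    ultimately show ?thesis
      using 2 by (intro that[of "1/2"])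
        (simp_all add: growth_dom_def growth_int_def growth_int2_def rate_lin_def rate_quad_def)
  next
    case 3
    \<comment> \<open>The exponent in \<open>gamma_tilde\<close>; since \<open>p - 1 = (2 - \<nu>) / (4 - \<nu>)\<close>, the maximizer is \<open>1 - E / 2\<close>.\<close>
    define p where "p = 2 * (3 - \<nu>) / (4 - \<nu>)"
    define E where "E = 2 powr p"
    have p: "0 < p" "p < 1" using 3 by (simp_all add: p_def field_simps)
    have "E < 2 powr 1" unfolding E_def by (rule powr_less_mono) (use p in auto)
    then have E: "0 < E" "E < 2" by (simp_all add: E_def)
    have half: "E / 2 = 2 powr (p - 1)" by (simp add: E_def powr_diff)
    have p1: "p - 1 = (2 - \<nu>) / (4 - \<nu>)"
      using 3 unfolding p_def by (simp add: divide_simps)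
    have "(2 - \<nu>) / (4 - \<nu>) * ((4 - \<nu>) / (2 - \<nu>)) = 1"
      "(2 - \<nu>) / (4 - \<nu>) * (2 * (3 - \<nu>) / (2 - \<nu>)) = 2 * (3 - \<nu>) / (4 - \<nu>)"
      using 3 by simp_all
    then have "(p - 1) * ((4 - \<nu>) / (2 - \<nu>)) = 1" "(p - 1) * (2 * (3 - \<nu>) / (2 - \<nu>)) = p"
      unfolding p1 by (simp_all only: p_def)
    then have pw: "(E / 2) powr ((4 - \<nu>) / (2 - \<nu>)) = 2"
      "(E / 2) powr (2 * (3 - \<nu>) / (2 - \<nu>)) = E"
      unfolding half powr_powr by (simp_all only: E_def powr_one)
    have gt: "gamma_tilde \<nu> = 1 + (4 - \<nu>) / (2 * (3 - \<nu>)) * (1 - E)"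
      by (simp add: gamma_tilde_def E_def p_def)
    have ki: "growth_int \<nu> (1 - E / 2) = (\<nu> - 2) / (4 - \<nu>)"
      using 3 by (simp add: growth_int_def pw[simplified])
    have ki2: "growth_int2 \<nu> (1 - E / 2) = (\<nu> - 2) / (4 - \<nu>) * ((\<nu> - 2) / (2 * (3 - \<nu>)) * (E - 1) - (1 - E / 2))"
      using 3 by (simp add: growth_int2_def pw[simplified])
    have "(1 - E / 2) - ((\<nu> - 2) / (2 * (3 - \<nu>)) * (E - 1) - (1 - E / 2)) = gamma_tilde \<nu>"
      unfolding gt using 3 by (simp add: field_simps)
    then have *: "(\<nu> - 2) / (4 - \<nu>) * ((1 - E / 2) - ((\<nu> - 2) / (2 * (3 - \<nu>)) * (E - 1) - (1 - E / 2)))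
        = (\<nu> - 2) / (4 - \<nu>) * gamma_tilde \<nu>" by simp
    show ?thesis
    proof (rule that[of "1 - E / 2"])
      show "(1 - E / 2) * growth_int \<nu> (1 - E / 2) - growth_int2 \<nu> (1 - E / 2) = rate_lin \<nu> * growth_int \<nu> (1 - E / 2)"
      proof -
        have "rate_lin \<nu> = gamma_tilde \<nu>" using 3 by (simp add: rate_lin_def)
        then show ?thesis
          unfolding ki ki2 using * by (metis mult.commute right_diff_distrib)
      qed
    qed (use 3 E in \<open>simp_all add: ki growth_dom_def rate_lin_def rate_quad_def\<close>)
  qed
qed

text \<open>The form in which the maximizer is used: on \<open>[0, r]\<close> the monotone function \<open>\<omega>\<^sub>\<nu>\<close> can be
  replaced by the constant \<open>w = \<omega>\<^sub>\<nu>(r)\<close>.\<close>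

lemma model_constants:
  assumes "2 \<le> \<nu>" "\<nu> \<le> 3"
  obtains r a w where "0 < r" "0 < a" "growth_dom \<nu> r" "r * w \<le> a / 2"
    "\<And>s. 0 \<le> s \<Longrightarrow> s \<le> r \<Longrightarrow> omega_real \<nu> s \<le> w"
    "r * (a - r * w) = rate_lin \<nu> * a" "r * (a - r * w) = rate_quad \<nu> * a\<^sup>2"
proof -
  obtain r where r: "0 < r" "growth_dom \<nu> r" "0 < growth_int \<nu> r"
    "r * growth_int \<nu> r - growth_int2 \<nu> r = rate_lin \<nu> * growth_int \<nu> r"
    "rate_lin \<nu> = rate_quad \<nu> * growth_int \<nu> r"
    using conjugate_value[OF assms] by blast
  have w: "r * (r * omega_real \<nu> r) = growth_int2 \<nu> r"
    using r(1) by (simp add: omega_real_def power2_eq_square)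
  have "r * (r * omega_real \<nu> r) \<le> r * (growth_int \<nu> r / 2)"
    unfolding w using growth_int2_le_half[OF assms _ r(2)] r(1) by simp
  then have "r * omega_real \<nu> r \<le> growth_int \<nu> r / 2"
    using r(1) by simp
  moreover have "r * (growth_int \<nu> r - r * omega_real \<nu> r) = rate_lin \<nu> * growth_int \<nu> r"
    using w r(4) by (simp add: algebra_simps)
  ultimately show ?thesis
    using r omega_real_mono[OF assms] by (intro that[of r "growth_int \<nu> r" "omega_real \<nu> r"])
      (auto simp: power2_eq_square)
qed

lemma rate_pos:
  assumes "2 \<le> \<nu>" "\<nu> \<le> 3"
  shows "0 < rate_lin \<nu>" "0 < rate_quad \<nu>"
proof -
  obtain r a w where *: "0 < r" "0 < a" "r * w \<le> a / 2"
    "r * (a - r * w) = rate_lin \<nu> * a" "r * (a - r * w) = rate_quad \<nu> * a\<^sup>2"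
    using model_constants[OF assms] by metis
  then have "0 < r * (a - r * w)" by (intro mult_pos_pos) auto
  then have "0 < rate_lin \<nu> * a" "0 < rate_quad \<nu> * a\<^sup>2"
    using * by simp_all
  then show "0 < rate_lin \<nu>" "0 < rate_quad \<nu>"
    using \<open>0 < a\<close> by (simp_all add: zero_less_mult_iff)
qed

text \<open>The trial step is the minimizer of the quadratic obtained by replacing \<open>\<omega>\<^sub>\<nu>\<close> near its value at \<open>r\<close> (up
  to a fixed factor), cut off where the argument of \<open>\<omega>\<^sub>\<nu>\<close> would exceed \<open>r\<close>. Without the cut the decrease
  is quadratic in the slope, with it linear. The last property serves steps whose
  maximal length is shorter than the trial step.\<close>

lemma model_decrease:
  assumes \<nu>: "2 \<le> \<nu>" "\<nu> \<le> 3" and m: "0 \<le> m" and e: "0 < e" and G: "0 < G"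
  obtains t where "0 < t" "growth_dom \<nu> (t * m)"
    "(0 < m \<and> rate_lin \<nu> * G / m \<le> t * G - e\<^sup>2 * gsc_quad \<nu> m t) \<or>
     rate_quad \<nu> * G\<^sup>2 / e\<^sup>2 \<le> t * G - e\<^sup>2 * gsc_quad \<nu> m t"
    "\<And>t'. 0 \<le> t' \<Longrightarrow> t' \<le> t \<Longrightarrow> t' * G / 2 \<le> t' * G - e\<^sup>2 * gsc_quad \<nu> m t'"
proof -
  obtain r a w where c: "0 < r" "0 < a" "growth_dom \<nu> r" "r * w \<le> a / 2"
    "\<And>s. 0 \<le> s \<Longrightarrow> s \<le> r \<Longrightarrow> omega_real \<nu> s \<le> w"
    "r * (a - r * w) = rate_lin \<nu> * a" "r * (a - r * w) = rate_quad \<nu> * a\<^sup>2"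
    using model_constants[OF \<nu>] by blast
  define T where "T = r * G / (a * e\<^sup>2)"
  have T: "0 < T" using c e G by (simp add: T_def)
  define t where "t = (if m = 0 \<or> T \<le> r / m then T else r / m)"
  have "T * m \<le> r" if "m = 0 \<or> T \<le> r / m"
    using that c(1) m by (cases "m = 0") (auto simp: pos_le_divide_eq)
  then have t: "0 < t" "t \<le> T" "t * m \<le> r" "t = T \<or> (0 < m \<and> t = r / m)"
    using T c(1) m by (auto simp: t_def)
  have w: "0 \<le> w"
    using c(5)[of 0] c(1) by (simp add: omega_real_def)
  have decr: "t' * G * (1 - r * w / a) \<le> t' * G - e\<^sup>2 * gsc_quad \<nu> m t'"
    if t': "0 \<le> t'" "t' \<le> t" for t'
  proof -
    have "t' * m \<le> r"
      using t(3) t' m by (meson mult_right_mono order_trans)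
    then have "omega_real \<nu> (t' * m) \<le> w"
      using c(5) t' m by simp
    then have "t'\<^sup>2 * omega_real \<nu> (t' * m) \<le> t'\<^sup>2 * w"
      by (simp add: mult_left_mono)
    then have "e\<^sup>2 * gsc_quad \<nu> m t' \<le> e\<^sup>2 * (t'\<^sup>2 * w)"
      unfolding gsc_quad_def by (rule mult_left_mono) simp
    also have "\<dots> = e\<^sup>2 * (t' * (t' * w))"
      by (simp add: power2_eq_square)
    also have "\<dots> \<le> e\<^sup>2 * (t' * (T * w))"
      by (intro mult_left_mono mult_right_mono) (use t t' w in auto)
    also have "\<dots> = t' * G * (r * w / a)"
      using e c(2) by (simp add: T_def field_simps)
    finally show ?thesis by (simp add: algebra_simps)
  qed
  \<comment> \<open>All steps up to \<open>t\<close> keep at least this fraction of the linear decrease.\<close>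
  have lo: "1 / 2 \<le> 1 - r * w / a"
    using c(2,4) by (simp add: field_simps)
  have lin: "r * (1 - r * w / a) = rate_lin \<nu>" and quad: "r * (1 - r * w / a) = rate_quad \<nu> * a"
    using c(2,6,7) by (simp_all add: field_simps power2_eq_square)
  show ?thesis
  proof (rule that[OF t(1)])
    show "growth_dom \<nu> (t * m)" using growth_dom_le[OF c(3) t(3)] .
    have d: "t * G * (1 - r * w / a) \<le> t * G - e\<^sup>2 * gsc_quad \<nu> m t"
      using decr[of t] t by simp
    from t(4) show "(0 < m \<and> rate_lin \<nu> * G / m \<le> t * G - e\<^sup>2 * gsc_quad \<nu> m t) \<or>
      rate_quad \<nu> * G\<^sup>2 / e\<^sup>2 \<le> t * G - e\<^sup>2 * gsc_quad \<nu> m t"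
    proof (elim disjE conjE)
      assume eq: "t = T"
      have "t * G * (1 - r * w / a) = (r * (1 - r * w / a)) * G\<^sup>2 / (a * e\<^sup>2)"
        unfolding eq T_def by (simp add: power2_eq_square)
      also have "\<dots> = rate_quad \<nu> * G\<^sup>2 / e\<^sup>2"
        unfolding quad using c(2) by simp
      finally have "t * G * (1 - r * w / a) = rate_quad \<nu> * G\<^sup>2 / e\<^sup>2" .
      then show ?thesis using d by (simp only: simp_thms)
    next
      assume eq: "0 < m" "t = r / m"
      have "t * G * (1 - r * w / a) = (r * (1 - r * w / a)) * G / m"
        unfolding eq by simp
      also have "\<dots> = rate_lin \<nu> * G / m"
        unfolding lin ..
      finally have "t * G * (1 - r * w / a) = rate_lin \<nu> * G / m" .
      then show ?thesis using d eq(1) by (simp only: simp_thms)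
    qed
    show "t' * G / 2 \<le> t' * G - e\<^sup>2 * gsc_quad \<nu> m t'" if "0 \<le> t'" "t' \<le> t" for t'
    proof -
      have "t' * G * (1 / 2) \<le> t' * G * (1 - r * w / a)"
        by (intro mult_left_mono lo) (use that G in auto)
      also note decr[OF that]
      finally show ?thesis by simp
    qed
  qed
qed

section \<open>Symmetric Hessians and their eigenvalues\<close>

text \<open>The mean value theorem turns the second difference of \<open>F\<close> into a difference of gradients, to which
  differentiability of \<open>g\<close> at the single point \<open>x\<close> applies.\<close>

lemma second_difference_quotient:
  fixes F :: "'a::real_inner \<Rightarrow> real" and g H :: "'a \<Rightarrow> 'a"
  assumes "open S" "x \<in> S" and F: "\<And>y. y \<in> S \<Longrightarrow> GDERIV F y :> g y"
    and H: "(g has_derivative H) (at x)" and "0 < \<epsilon>"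
  obtains d where "0 < d" "\<And>t. 0 < t \<Longrightarrow> t < d \<Longrightarrow>
    \<bar>F (x + t *\<^sub>R u + t *\<^sub>R w) - F (x + t *\<^sub>R u) - F (x + t *\<^sub>R w) + F x - t\<^sup>2 * (H w \<bullet> u)\<bar> \<le> \<epsilon> * t\<^sup>2"
proof -
  define K where "K = norm u + norm w + 1"
  have K: "1 \<le> K" "norm u \<le> K" by (simp_all add: K_def)
  define \<eta> where "\<eta> = \<epsilon> / (2 * K\<^sup>2)"
  have \<eta>: "0 < \<eta>" using assms(5) K by (simp add: \<eta>_def)
  obtain d1 where d1: "0 < d1"
    "\<And>y. norm (y - x) < d1 \<Longrightarrow> norm (g y - g x - H (y - x)) \<le> \<eta> * norm (y - x)"
    using H \<eta> unfolding has_derivative_at_alt by blast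
  obtain d2 where d2: "0 < d2" "ball x d2 \<subseteq> S"
    using assms(1,2) open_contains_ball by blast
  interpret H: bounded_linear H using H by (rule has_derivative_bounded_linear)
  show ?thesis
  proof (rule that[of "min d1 d2 / K"])
    show "0 < min d1 d2 / K" using d1 d2 K by simp
    fix t :: real assume t: "0 < t" "t < min d1 d2 / K"
    then have tK: "t * K < d1" "t * K < d2"
      using K by (simp_all add: pos_less_divide_eq)
    have small: "norm (s *\<^sub>R t *\<^sub>R u + c *\<^sub>R t *\<^sub>R w) \<le> t * K"
      if "0 \<le> s" "s \<le> 1" "0 \<le> c" "c \<le> 1" for s c
    proof -
      have "norm (s *\<^sub>R t *\<^sub>R u + c *\<^sub>R t *\<^sub>R w) \<le> s * (t * norm u) + c * (t * norm w)"
        using that t by (intro order_trans[OF norm_triangle_ineq]) simp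
      also have "\<dots> \<le> 1 * (t * norm u) + 1 * (t * norm w)"
        using that t by (intro add_mono mult_right_mono) auto
      also have "\<dots> \<le> t * K"
        using t by (simp add: K_def algebra_simps)
      finally show ?thesis .
    qed
    have inS: "x + s *\<^sub>R t *\<^sub>R u + c *\<^sub>R t *\<^sub>R w \<in> S"
      if "0 \<le> s" "s \<le> 1" "0 \<le> c" "c \<le> 1" for s c
    proof -
      have "dist x (x + s *\<^sub>R t *\<^sub>R u + c *\<^sub>R t *\<^sub>R w) = norm (s *\<^sub>R t *\<^sub>R u + c *\<^sub>R t *\<^sub>R w)"
        by (simp add: dist_norm norm_minus_commute add.assoc flip: minus_add_distrib)
      then show ?thesis
        using small[OF that] tK d2(2) by (auto simp: subset_iff)
    qed
    have der: "((\<lambda>s. F (x + s *\<^sub>R t *\<^sub>R u + c *\<^sub>R t *\<^sub>R w)) has_real_derivative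
        (t *\<^sub>R u) \<bullet> g (x + s *\<^sub>R t *\<^sub>R u + c *\<^sub>R t *\<^sub>R w)) (at s)"
      if "0 \<le> s" "s \<le> 1" "0 \<le> c" "c \<le> 1" for s c
    proof -
      have "((\<lambda>s. x + s *\<^sub>R t *\<^sub>R u + c *\<^sub>R t *\<^sub>R w) has_derivative (\<lambda>h. h *\<^sub>R t *\<^sub>R u)) (at s)"
        by (auto intro!: derivative_eq_intros)
      from has_derivative_compose[OF this F[OF inS[OF that], unfolded gderiv_def]]
      moreover have "(\<lambda>h. (h *\<^sub>R t *\<^sub>R u) \<bullet> D) = (*) ((t *\<^sub>R u) \<bullet> D)" for D :: 'a
        by (simp add: fun_eq_iff)
      ultimately show ?thesis
        unfolding has_field_derivative_def by simp
    qed
    have "\<exists>s>0. s < 1 \<and> (\<lambda>s. F (x + s *\<^sub>R t *\<^sub>R u + 1 *\<^sub>R t *\<^sub>R w) - F (x + s *\<^sub>R t *\<^sub>R u + 0 *\<^sub>R t *\<^sub>R w)) 1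
        - (\<lambda>s. F (x + s *\<^sub>R t *\<^sub>R u + 1 *\<^sub>R t *\<^sub>R w) - F (x + s *\<^sub>R t *\<^sub>R u + 0 *\<^sub>R t *\<^sub>R w)) 0
        = (1 - 0) * (\<lambda>s. (t *\<^sub>R u) \<bullet> g (x + s *\<^sub>R t *\<^sub>R u + 1 *\<^sub>R t *\<^sub>R w) - (t *\<^sub>R u) \<bullet> g (x + s *\<^sub>R t *\<^sub>R u + 0 *\<^sub>R t *\<^sub>R w)) s"
      by (rule MVT2) (simp, intro DERIV_diff der, auto)
    then obtain s where s: "0 < s" "s < 1" and eq: "F (x + t *\<^sub>R u + t *\<^sub>R w) - F (x + t *\<^sub>R u) - F (x + t *\<^sub>R w) + F x
        = t * (u \<bullet> (g (x + (s *\<^sub>R t *\<^sub>R u + 1 *\<^sub>R t *\<^sub>R w)) - g (x + (s *\<^sub>R t *\<^sub>R u + 0 *\<^sub>R t *\<^sub>R w))))"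
      by (auto simp: algebra_simps inner_diff_right)
    define z where "z c = s *\<^sub>R t *\<^sub>R u + c *\<^sub>R t *\<^sub>R w" for c
    define r where "r c = g (x + z c) - g x - H (z c)" for c
    have r: "norm (r c) \<le> \<eta> * (t * K)" if "c = 0 \<or> c = 1" for c
    proof -
      have "norm (z c) \<le> t * K" using small[of s c] s that by (auto simp: z_def)
      moreover from this have "norm (r c) \<le> \<eta> * norm (z c)"
        using d1(2)[of "x + z c"] tK by (simp add: r_def)
      ultimately show ?thesis using \<eta> by (smt (verit) mult_left_mono)
    qed
    have "g (x + z 1) - g (x + z 0) = H (z 1 - z 0) + (r 1 - r 0)"
      by (simp add: r_def H.diff)
    also have "z 1 - z 0 = t *\<^sub>R w" by (simp add: z_def)
    finally have gdiff: "g (x + z 1) - g (x + z 0) = t *\<^sub>R H w + (r 1 - r 0)" by (simp add: H.scaleR)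
    have "F (x + t *\<^sub>R u + t *\<^sub>R w) - F (x + t *\<^sub>R u) - F (x + t *\<^sub>R w) + F x - t\<^sup>2 * (H w \<bullet> u)
        = t * (u \<bullet> (r 1 - r 0))"
      unfolding eq z_def[symmetric] gdiff
      by (simp add: inner_add_right power2_eq_square inner_commute[of "H w"] distrib_left)
    also have "\<bar>\<dots>\<bar> \<le> t * (K * (2 * (\<eta> * (t * K))))"
    proof -
      have "\<bar>u \<bullet> (r 1 - r 0)\<bar> \<le> norm u * norm (r 1 - r 0)" by (rule Cauchy_Schwarz_ineq2)
      also have "\<dots> \<le> K * (2 * (\<eta> * (t * K)))"
      proof (rule mult_mono[OF K(2)])
        show "norm (r 1 - r 0) \<le> 2 * (\<eta> * (t * K))"
          using norm_triangle_ineq4[of "r 1" "r 0"] r[of 1] r[of 0] by simp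
      qed (use K in auto)
      finally show ?thesis using t by (simp add: abs_mult)
    qed
    also have "\<dots> = \<epsilon> * t\<^sup>2"
      using K by (simp add: \<eta>_def power2_eq_square)
    finally show "\<bar>F (x + t *\<^sub>R u + t *\<^sub>R w) - F (x + t *\<^sub>R u) - F (x + t *\<^sub>R w) + F x - t\<^sup>2 * (H w \<bullet> u)\<bar> \<le> \<epsilon> * t\<^sup>2" .
  qed
qed

text \<open>The second difference is symmetric in \<open>u\<close> and \<open>w\<close>, so both orders give the same limit.\<close>

lemma derivative_of_gradient_symmetric:
  fixes F :: "'a::real_inner \<Rightarrow> real" and g H :: "'a \<Rightarrow> 'a"
  assumes "open S" "x \<in> S" "\<And>y. y \<in> S \<Longrightarrow> GDERIV F y :> g y" "(g has_derivative H) (at x)"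
  shows "H u \<bullet> w = H w \<bullet> u"
proof (rule ccontr)
  assume "H u \<bullet> w \<noteq> H w \<bullet> u"
  then have pos: "0 < \<bar>H w \<bullet> u - H u \<bullet> w\<bar> / 3" by simp
  define \<epsilon> where "\<epsilon> = \<bar>H w \<bullet> u - H u \<bullet> w\<bar> / 3"
  obtain d where d: "0 < d" "\<And>t. 0 < t \<Longrightarrow> t < d \<Longrightarrow>
    \<bar>F (x + t *\<^sub>R u + t *\<^sub>R w) - F (x + t *\<^sub>R u) - F (x + t *\<^sub>R w) + F x - t\<^sup>2 * (H w \<bullet> u)\<bar> \<le> \<epsilon> * t\<^sup>2"
    using second_difference_quotient[OF assms pos, of u w] unfolding \<epsilon>_def by metis
  obtain d' where d': "0 < d'" "\<And>t. 0 < t \<Longrightarrow> t < d' \<Longrightarrow>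
    \<bar>F (x + t *\<^sub>R w + t *\<^sub>R u) - F (x + t *\<^sub>R w) - F (x + t *\<^sub>R u) + F x - t\<^sup>2 * (H u \<bullet> w)\<bar> \<le> \<epsilon> * t\<^sup>2"
    using second_difference_quotient[OF assms pos, of w u] unfolding \<epsilon>_def by metis
  define t where "t = min d d' / 2"
  have t: "0 < t" "t < d" "t < d'" using d(1) d'(1) by (auto simp: t_def)
  have "x + t *\<^sub>R w + t *\<^sub>R u = x + t *\<^sub>R u + t *\<^sub>R w" by simp
  then have "\<bar>t\<^sup>2 * (H w \<bullet> u) - t\<^sup>2 * (H u \<bullet> w)\<bar> \<le> 2 * (\<epsilon> * t\<^sup>2)"
    using d(2)[OF t(1,2)] d'(2)[OF t(1,3)] by (smt (verit))
  also have "\<bar>t\<^sup>2 * (H w \<bullet> u) - t\<^sup>2 * (H u \<bullet> w)\<bar> = t\<^sup>2 * (3 * \<epsilon>)"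
    by (simp add: \<epsilon>_def abs_mult flip: right_diff_distrib)
  finally show False
    using pos t(1) by (simp add: \<epsilon>_def)
qed

text \<open>Eigenvectors of a symmetric matrix for different eigenvalues are orthogonal, hence independent.\<close>

lemma finite_eigenvalues:
  fixes A :: "real^'n^'n"
  assumes sym: "\<And>u w. (A *v u) \<bullet> w = (A *v w) \<bullet> u"
  shows "finite (eigenvalues A)"
proof -
  define ev where "ev l = (SOME v. v \<noteq> 0 \<and> A *v v = l *\<^sub>R v)" for l
  have ev: "ev l \<noteq> 0" "A *v ev l = l *\<^sub>R ev l" if "l \<in> eigenvalues A" for l
    using someI_ex[of "\<lambda>v. v \<noteq> 0 \<and> A *v v = l *\<^sub>R v"] that
    unfolding eigenvalues_def ev_def by auto
  have inj: "inj_on ev (eigenvalues A)"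
    by (rule inj_onI) (metis ev scaleR_cancel_right)
  have "pairwise orthogonal (ev ` eigenvalues A)"
  proof (clarsimp simp: pairwise_def)
    fix l k assume *: "l \<in> eigenvalues A" "k \<in> eigenvalues A" "ev l \<noteq> ev k"
    then have "l \<noteq> k" by auto
    moreover have "l * (ev l \<bullet> ev k) = k * (ev l \<bullet> ev k)"
      using sym[of "ev l" "ev k"] ev * by (simp add: inner_commute)
    ultimately show "orthogonal (ev l) (ev k)" by (simp add: orthogonal_def)
  qed
  then have "independent (ev ` eigenvalues A)"
    by (rule pairwise_orthogonal_independent) (use ev in auto)
  then have "finite (ev ` eigenvalues A)"
    by (rule independent_imp_finite)
  then show ?thesis using inj by (rule finite_imageD)
qed

text \<open>The minimum \<open>l\<close> of the quadratic form on the unit sphere is an eigenvalue: the form \<open>A - l\<close> is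
  positive semidefinite and vanishes at a minimizer \<open>z\<close>, hence \<open>z\<close> lies in its kernel.\<close>

lemma eigenvalue_below_form:
  fixes A :: "real^'n^'n"
  assumes sym: "\<And>u w. (A *v u) \<bullet> w = (A *v w) \<bullet> u"
  obtains l where "l \<in> eigenvalues A" "\<And>v. l * (v \<bullet> v) \<le> (A *v v) \<bullet> v"
proof -
  have "sphere (0::real^'n) 1 \<noteq> {}" by (simp add: sphere_eq_empty)
  moreover have "continuous_on (sphere 0 1) (\<lambda>v. (A *v v) \<bullet> v)"
    by (intro continuous_on_inner matrix_vector_mult_linear_continuous_on continuous_on_id)
  ultimately obtain z where z: "norm z = 1" "\<And>v. norm v = 1 \<Longrightarrow> (A *v z) \<bullet> z \<le> (A *v v) \<bullet> v"
    using continuous_attains_inf[of "sphere 0 1" "\<lambda>v. (A *v v) \<bullet> v"]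
    by auto
  define l where "l = (A *v z) \<bullet> z"
  have zz: "z \<bullet> z = 1" using z(1) by (simp add: norm_eq_1)
  have low: "l * (v \<bullet> v) \<le> (A *v v) \<bullet> v" for v
  proof (cases "v = 0")
    case False
    have "l \<le> (A *v ((1 / norm v) *\<^sub>R v)) \<bullet> ((1 / norm v) *\<^sub>R v)"
      unfolding l_def by (rule z(2)) (use False in simp)
    also have "\<dots> = ((A *v v) \<bullet> v) / (v \<bullet> v)"
      by (simp add: matrix_vector_mult_scaleR dot_square_norm power2_eq_square)
    finally show ?thesis using False by (simp add: pos_le_divide_eq)
  qed simp
  define w where "w = A *v z - l *\<^sub>R z"
  have exp: "(A *v (z + t *\<^sub>R w)) \<bullet> (z + t *\<^sub>R w) - l * ((z + t *\<^sub>R w) \<bullet> (z + t *\<^sub>R w))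
      = 2 * t * (w \<bullet> w) + t\<^sup>2 * ((A *v w) \<bullet> w - l * (w \<bullet> w))" for t
  proof -
    have 1: "(A *v z) \<bullet> w = (A *v w) \<bullet> z" by (rule sym)
    have 2: "(A *v z) \<bullet> w - l * (z \<bullet> w) = w \<bullet> w" by (simp add: w_def inner_diff_left)
    have "(A *v (z + t *\<^sub>R w)) \<bullet> (z + t *\<^sub>R w) - l * ((z + t *\<^sub>R w) \<bullet> (z + t *\<^sub>R w))
        = l + 2 * t * ((A *v z) \<bullet> w) + t\<^sup>2 * ((A *v w) \<bullet> w) - l * (1 + 2 * t * (z \<bullet> w) + t\<^sup>2 * (w \<bullet> w))"
      by (simp add: matrix_vector_right_distrib matrix_vector_mult_scaleR inner_add_left inner_add_right
          1[symmetric] l_def[symmetric] zz power2_eq_square inner_commute[of w z] algebra_simps)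
    then show ?thesis
      by (simp add: algebra_simps flip: 2)
  qed
  have "w \<bullet> w = 0"
  proof (rule ccontr)
    assume "w \<bullet> w \<noteq> 0"
    then have ww: "0 < w \<bullet> w" by simp
    define c where "c = (A *v w) \<bullet> w - l * (w \<bullet> w)"
    have c: "0 \<le> c" using low[of w] by (simp add: c_def)
    have ge: "0 \<le> 2 * t * (w \<bullet> w) + t\<^sup>2 * c" for t
      using exp[of t] low[of "z + t *\<^sub>R w"] by (simp add: c_def)
    \<comment> \<open>If \<open>w \<noteq> 0\<close>, this negative \<open>t\<close> makes the nonnegative form \<open>A - l\<close> negative at \<open>z + t w\<close>; the \<open>+ 1\<close>
    avoids a division by zero.\<close>
    define t where "t = - (w \<bullet> w) / (c + 1)"
    have t: "(c + 1) * t = - (w \<bullet> w)" using c by (simp add: t_def)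
    have "(c + 1)\<^sup>2 * (2 * t * (w \<bullet> w) + t\<^sup>2 * c)
        = 2 * (c + 1) * ((c + 1) * t) * (w \<bullet> w) + ((c + 1) * t)\<^sup>2 * c"
      by (simp add: power2_eq_square algebra_simps)
    also have "\<dots> = - ((c + 2) * (w \<bullet> w)\<^sup>2)"
      unfolding t by (simp add: power2_eq_square algebra_simps)
    also have "\<dots> < 0"
      using c ww by simp
    finally show False
      using ge[of t] by (simp add: mult_less_0_iff)
  qed
  then have "A *v z = l *\<^sub>R z" by (simp add: w_def)
  then have "l \<in> eigenvalues A"
    using z(1) by (auto simp: eigenvalues_def intro!: exI[of _ z])
  then show ?thesis using low that by blast
qed

lemma eigenvalues_uminus:
  fixes A :: "real^'n^'n"
  shows "eigenvalues (- A) = uminus ` eigenvalues A"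
proof -
  have neg: "(- A) *v v = - (A *v v)" for v :: "real^'n"
    using matrix_vector_mult_diff_rdistrib[of 0 A v] by simp
  have "l \<in> eigenvalues (- A) \<longleftrightarrow> - l \<in> eigenvalues A" for l
  proof -
    have "- (A *v v) = l *\<^sub>R v \<longleftrightarrow> A *v v = (- l) *\<^sub>R v" for v
      by (metis minus_minus scaleR_minus_left)
    then show ?thesis unfolding eigenvalues_def neg by simp
  qed
  moreover have "l \<in> uminus ` S \<longleftrightarrow> - l \<in> S" for l :: real and S
    by (metis imageE image_eqI minus_minus)
  ultimately show ?thesis by blast
qed

text \<open>The upper bound is the lower bound for \<open>- A\<close>. Membership in \<open>eigenvalues A\<close> guarantees that \<open>Min\<close> and
  \<open>Max\<close> have their intended meaning.\<close>

lemma lambda_bounds: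
  fixes A :: "real^'n^'n"
  assumes sym: "\<And>u w. (A *v u) \<bullet> w = (A *v w) \<bullet> u"
  shows "lambda_min A * (v \<bullet> v) \<le> (A *v v) \<bullet> v" "(A *v v) \<bullet> v \<le> lambda_max A * (v \<bullet> v)"
    "lambda_min A \<in> eigenvalues A" "lambda_max A \<in> eigenvalues A"
proof -
  note fin = finite_eigenvalues[OF sym]
  obtain l where l: "l \<in> eigenvalues A" "\<And>v. l * (v \<bullet> v) \<le> (A *v v) \<bullet> v"
    using eigenvalue_below_form[OF sym] by blast
  have neg: "(- A) *v v = - (A *v v)" for v :: "real^'n"
    using matrix_vector_mult_diff_rdistrib[of 0 A v] by simp
  obtain k where "k \<in> eigenvalues (- A)" "\<And>v. k * (v \<bullet> v) \<le> ((- A) *v v) \<bullet> v"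
    using eigenvalue_below_form[of "- A"] sym unfolding neg by auto
  then have k: "- k \<in> eigenvalues A" "\<And>v. k * (v \<bullet> v) \<le> - ((A *v v) \<bullet> v)"
    unfolding neg eigenvalues_uminus by auto
  show "lambda_min A * (v \<bullet> v) \<le> (A *v v) \<bullet> v"
    using mult_right_mono[OF Min_le[OF fin l(1)], of "v \<bullet> v"] l(2)[of v]
    by (simp add: lambda_min_def)
  show "(A *v v) \<bullet> v \<le> lambda_max A * (v \<bullet> v)"
    using mult_right_mono[OF Max_ge[OF fin k(1)], of "v \<bullet> v"] k(2)[of v]
    by (simp add: lambda_max_def)
  show "lambda_min A \<in> eigenvalues A" "lambda_max A \<in> eigenvalues A"
    unfolding lambda_min_def lambda_max_def using fin l(1) by (auto intro: Min_in Max_in)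
qed

section \<open>Exchange of weights in a polytope\<close>

lemma mem_polyhedron_of: "x \<in> polyhedron_of B b \<longleftrightarrow> (\<forall>i. B $ i \<bullet> x \<le> b $ i)"
  by (simp add: polyhedron_of_def)

lemma polyhedron_polyhedron_of: "polyhedron (polyhedron_of B b)"
proof -
  have "polyhedron_of B b = \<Inter> (range (\<lambda>i. {x. B $ i \<bullet> x \<le> b $ i}))"
    by (auto simp: polyhedron_of_def)
  then show ?thesis
    by (auto intro!: polyhedron_Inter polyhedron_halfspace_le)
qed

lemma convex_polyhedron_of: "convex (polyhedron_of B b)"
  using polyhedron_polyhedron_of by (rule polyhedron_imp_convex)

lemma finite_vertices_polyhedron_of: "finite (vertices (polyhedron_of B b))"
  unfolding vertices_def by (rule finite_polyhedron_extreme_points[OF polyhedron_polyhedron_of])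

lemma vertices_subset: "vertices X \<subseteq> X"
  by (auto simp: vertices_def extreme_point_of_def)

text \<open>A bounded polyhedron contains no ray, so some constraint grows in the direction \<open>d\<close>; the first one
  to become active is the facet that is hit.\<close>

lemma ray_hits_facet:
  assumes X: "bounded (polyhedron_of B b)" and z: "z \<in> polyhedron_of B b" and d: "d \<noteq> 0"
  obtains t i where "0 \<le> t" "z + t *\<^sub>R d \<in> polyhedron_of B b" "0 < B $ i \<bullet> d" "B $ i \<bullet> (z + t *\<^sub>R d) = b $ i"
proof -
  define I where "I = {i. 0 < B $ i \<bullet> d}"
  have "I \<noteq> {}"
  proof
    assume "I = {}"
    have "z + t *\<^sub>R d \<in> polyhedron_of B b" if "0 \<le> t" for t
      unfolding mem_polyhedron_of
    proof
      fix i
      have "i \<notin> I" using \<open>I = {}\<close> by simp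
      then have "B $ i \<bullet> d \<le> 0" by (simp add: I_def)
      then have "t * (B $ i \<bullet> d) \<le> 0" using that by (rule mult_nonneg_nonpos[rotated])
      then show "B $ i \<bullet> (z + t *\<^sub>R d) \<le> b $ i"
        using z by (simp add: mem_polyhedron_of inner_add_right add_decreasing2)
    qed
    moreover obtain K where K: "\<And>y. y \<in> polyhedron_of B b \<Longrightarrow> norm y \<le> K"
      using X by (auto simp: bounded_iff)
    ultimately have bnd: "norm (z + t *\<^sub>R d) \<le> K" if "0 \<le> t" for t using that by blast
    have zK: "norm z \<le> K" using K z by blast
    then have K0: "0 \<le> K" using norm_ge_zero order_trans by blast
    define t where "t = (2 * K + 1) / norm d"
    have "norm (t *\<^sub>R d) = 2 * K + 1"
      using d K0 by (simp add: t_def)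
    moreover have "0 \<le> t" using K0 by (simp add: t_def)
    ultimately show False
      using bnd[of t] zK norm_triangle_ineq4[of "z + t *\<^sub>R d" z] by simp
  qed
  define q where "q i = (b $ i - B $ i \<bullet> z) / (B $ i \<bullet> d)" for i
  obtain i where i: "i \<in> I" "\<And>j. j \<in> I \<Longrightarrow> q i \<le> q j"
    using ex_is_arg_min_if_finite[of I q] \<open>I \<noteq> {}\<close> by (auto simp: is_arg_min_linorder)
  have q0: "0 \<le> q i"
    using i(1) z by (simp add: q_def I_def mem_polyhedron_of)
  have "z + q i *\<^sub>R d \<in> polyhedron_of B b"
    unfolding mem_polyhedron_of
  proof
    fix j
    show "B $ j \<bullet> (z + q i *\<^sub>R d) \<le> b $ j"
    proof (cases "j \<in> I")
      case True
      then have "q i \<le> (b $ j - B $ j \<bullet> z) / (B $ j \<bullet> d)" using i(2)[of j] by (simp add: q_def)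
      then have "q i * (B $ j \<bullet> d) \<le> b $ j - B $ j \<bullet> z"
        using True by (simp add: I_def pos_le_divide_eq)
      then show ?thesis by (simp add: inner_add_right)
    next
      case False
      then have "q i * (B $ j \<bullet> d) \<le> 0"
        using q0 by (intro mult_nonneg_nonpos) (auto simp: I_def)
      then show ?thesis
        using z by (simp add: mem_polyhedron_of inner_add_right add_decreasing2)
    qed
  qed
  moreover have "B $ i \<bullet> (z + q i *\<^sub>R d) = b $ i"
    using i(1) by (simp add: inner_add_right q_def I_def)
  ultimately show ?thesis
    using that[OF q0] i(1) by (simp add: I_def)
qed

text \<open>Start by moving all weights to \<open>z = y\<close>. If \<open>z\<close> differs from a vertex \<open>u\<close>, moving \<open>z\<close> away from \<open>u\<close>
  reduces the weight that has to be taken from \<open>u\<close>; this can continue until nothing is taken from \<open>u\<close> or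
  \<open>z\<close> reaches a facet that does not contain \<open>u\<close>. Constraints active at \<open>z\<close> stay active: \<open>z\<close> remains a
  convex combination of the new point and \<open>u\<close>. Treating the vertices one after the other therefore
  works, and the set \<open>F\<close> collects those already treated.\<close>

lemma irreducible_exchange:
  fixes B :: "real^'n^'m"
  assumes X: "bounded (polyhedron_of B b)" and "finite V" "V \<subseteq> polyhedron_of B b"
    and \<mu>: "\<And>w. w \<in> V \<Longrightarrow> 0 \<le> \<mu> w" "(\<Sum>w\<in>V. \<mu> w) = 1" "x = (\<Sum>w\<in>V. \<mu> w *\<^sub>R w)"
    and y: "y \<in> polyhedron_of B b" and F: "F \<subseteq> V"
  shows "\<exists>\<rho> z. z \<in> polyhedron_of B b \<and> (\<forall>w\<in>V. 0 \<le> \<rho> w \<and> \<rho> w \<le> \<mu> w) \<and>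
    y - x = (\<Sum>w\<in>V. \<rho> w *\<^sub>R (z - w)) \<and>
    (\<forall>w\<in>F. \<rho> w = 0 \<or> (\<exists>i. B $ i \<bullet> z = b $ i \<and> B $ i \<bullet> w < b $ i))"
proof -
  let ?X = "polyhedron_of B b"
  have "finite F" using F assms(2) by (rule finite_subset)
  then show ?thesis using F
  proof (induction F)
    case empty
    have "y - x = (\<Sum>w\<in>V. \<mu> w *\<^sub>R (y - w))"
      using \<mu>(2,3) by (simp add: scaleR_diff_right sum_subtractf flip: scaleR_sum_left)
    then show ?case using y \<mu>(1) by (intro exI[of _ \<mu>] exI[of _ y]) auto
  next
    case (insert u F)
    then obtain \<rho> z where z: "z \<in> ?X" and \<rho>': "\<forall>w\<in>V. 0 \<le> \<rho> w \<and> \<rho> w \<le> \<mu> w"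
      and eq: "y - x = (\<Sum>w\<in>V. \<rho> w *\<^sub>R (z - w))"
      and act': "\<forall>w\<in>F. \<rho> w = 0 \<or> (\<exists>i. B $ i \<bullet> z = b $ i \<and> B $ i \<bullet> w < b $ i)"
      by blast
    have \<rho>: "\<And>w. w \<in> V \<Longrightarrow> 0 \<le> \<rho> w" "\<And>w. w \<in> V \<Longrightarrow> \<rho> w \<le> \<mu> w"
      and act: "\<And>w. w \<in> F \<Longrightarrow> \<rho> w = 0 \<or> (\<exists>i. B $ i \<bullet> z = b $ i \<and> B $ i \<bullet> w < b $ i)"
      using \<rho>' act' by auto
    have u: "u \<in> V" "u \<in> ?X" using insert.prems assms(3) by auto
    show ?case
    proof (cases "\<rho> u = 0 \<or> z = u")
      case True
      define \<rho>' where "\<rho>' = \<rho>(u := 0)"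
      have "(\<Sum>w\<in>V. \<rho>' w *\<^sub>R (z - w)) = (\<Sum>w\<in>V. \<rho> w *\<^sub>R (z - w))"
        by (rule sum.cong) (use True in \<open>auto simp: \<rho>'_def\<close>)
      then show ?thesis
        using z \<rho> eq act \<mu>(1) u by (intro exI[of _ \<rho>'] exI[of _ z]) (auto simp: \<rho>'_def)
    next
      case False
      \<comment> \<open>Replacing \<open>z\<close> by \<open>z + t' (z - u)\<close> allows to take \<open>T t' / (1 + t')\<close> less from \<open>u\<close>, where \<open>T\<close> is the total
        weight moved.\<close>
      define T where "T = (\<Sum>w\<in>V. \<rho> w)"
      have \<rho>u: "0 < \<rho> u" using False \<rho>(1)[OF u(1)] by simp
      have T: "\<rho> u \<le> T" unfolding T_def using \<rho>(1) u(1) assms(2) by (intro member_le_sum) auto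
      obtain t i where t: "0 \<le> t" "z + t *\<^sub>R (z - u) \<in> ?X" "0 < B $ i \<bullet> (z - u)"
          "B $ i \<bullet> (z + t *\<^sub>R (z - u)) = b $ i"
        using ray_hits_facet[OF X z, of "z - u"] False by auto
      have "\<exists>t'. 0 \<le> t' \<and> z + t' *\<^sub>R (z - u) \<in> ?X \<and> T * t' / (1 + t') \<le> \<rho> u \<and>
          (T * t' / (1 + t') = \<rho> u \<or> (\<exists>i. B $ i \<bullet> (z + t' *\<^sub>R (z - u)) = b $ i \<and> B $ i \<bullet> u < b $ i))"
      proof (cases "T * t / (1 + t) \<le> \<rho> u")
        case True
        have "B $ i \<bullet> u < b $ i"
          using t(3) z by (simp add: inner_diff_right mem_polyhedron_of less_le_trans)
        then show ?thesis using True t by blast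
      next
        case False
        then have "\<rho> u * (1 + t) < T * t"
          using t(1) by (simp add: not_le pos_less_divide_eq)
        then have lt: "\<rho> u < (T - \<rho> u) * t" by (simp add: algebra_simps)
        then have pos: "0 < T - \<rho> u" using \<rho>u T by (cases "T = \<rho> u") auto
        \<comment> \<open>The facet is too far away: stop when the weight taken from \<open>u\<close> reaches zero.\<close>
        define t' where "t' = \<rho> u / (T - \<rho> u)"
        have t': "0 \<le> t'" "t' \<le> t" using lt pos \<rho>u by (simp_all add: t'_def field_simps)
        have "0 < t" using lt pos \<rho>u t(1) by (cases "t = 0") auto
        then have "z + t' *\<^sub>R (z - u) = (1 - t' / t) *\<^sub>R z + (t' / t) *\<^sub>R (z + t *\<^sub>R (z - u))"
          by (simp add: algebra_simps)
        also have "\<dots> \<in> ?X"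
          by (rule convexD[OF convex_polyhedron_of z t(2)]) (use t' \<open>0 < t\<close> in auto)
        finally have "z + t' *\<^sub>R (z - u) \<in> ?X" .
        moreover have "1 + t' = T / (T - \<rho> u)" using pos by (simp add: t'_def field_simps)
        then have "T * t' / (1 + t') = \<rho> u"
          using pos \<rho>u T by (simp add: t'_def)
        ultimately show ?thesis using t' by (intro exI[of _ t']) auto
      qed
      then obtain t' where t': "0 \<le> t'" "z + t' *\<^sub>R (z - u) \<in> ?X" "T * t' / (1 + t') \<le> \<rho> u"
          "T * t' / (1 + t') = \<rho> u \<or> (\<exists>i. B $ i \<bullet> (z + t' *\<^sub>R (z - u)) = b $ i \<and> B $ i \<bullet> u < b $ i)"
        by blast
      define z' where "z' = z + t' *\<^sub>R (z - u)"
      define c where "c = T * t' / (1 + t')"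
      have c0: "0 \<le> c" using t'(1) \<rho>u T by (simp add: c_def)
      have c1: "c * (1 + t') = T * t'" using t'(1) by (simp add: c_def)
      define \<rho>' where "\<rho>' = \<rho>(u := \<rho> u - c)"
      have "(\<Sum>w\<in>V. \<rho>' w *\<^sub>R (z' - w)) = (\<Sum>w\<in>V. \<rho> w *\<^sub>R (z' - w) - (if w = u then c *\<^sub>R (z' - u) else 0))"
        by (rule sum.cong) (auto simp: \<rho>'_def scaleR_diff_left)
      also have "\<dots> = (\<Sum>w\<in>V. \<rho> w *\<^sub>R (z' - w)) - c *\<^sub>R (z' - u)"
        using assms(2) u(1) by (simp add: sum_subtractf)
      also have "(\<Sum>w\<in>V. \<rho> w *\<^sub>R (z' - w)) = (\<Sum>w\<in>V. \<rho> w *\<^sub>R (z - w) + \<rho> w *\<^sub>R (t' *\<^sub>R (z - u)))"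
        by (rule sum.cong) (auto simp: z'_def algebra_simps)
      also have "\<dots> = (y - x) + (T * t') *\<^sub>R (z - u)"
        by (simp add: sum.distrib eq T_def sum_distrib_right flip: scaleR_sum_left)
      also have "(T * t') *\<^sub>R (z - u) = c *\<^sub>R (z' - u)"
      proof -
        have "z' - u = (1 + t') *\<^sub>R (z - u)" by (simp add: z'_def algebra_simps)
        then show ?thesis by (simp add: c1)
      qed
      finally have "y - x = (\<Sum>w\<in>V. \<rho>' w *\<^sub>R (z' - w))" by simp
      moreover have "z' \<in> ?X" using t'(2) by (simp add: z'_def)
      moreover have "\<forall>w\<in>V. 0 \<le> \<rho>' w \<and> \<rho>' w \<le> \<mu> w"
        using \<rho> t'(3) c0 u(1) by (auto simp: \<rho>'_def c_def[symmetric] intro: order_trans[of _ "\<rho> u"])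
      moreover have "\<rho>' u = 0 \<or> (\<exists>i. B $ i \<bullet> z' = b $ i \<and> B $ i \<bullet> u < b $ i)"
        using t'(4) by (auto simp: \<rho>'_def c_def z'_def)
      moreover have "\<rho>' w = 0 \<or> (\<exists>i. B $ i \<bullet> z' = b $ i \<and> B $ i \<bullet> w < b $ i)" if "w \<in> F" for w
      proof -
        have "w \<noteq> u" using that insert.hyps by auto
        moreover have "B $ i \<bullet> z' = b $ i" if "B $ i \<bullet> z = b $ i" for i
        proof (rule antisym)
          show "B $ i \<bullet> z' \<le> b $ i" using \<open>z' \<in> ?X\<close> by (simp add: mem_polyhedron_of)
          have "0 \<le> t' * (b $ i - B $ i \<bullet> u)"
            using t'(1) u(2) by (simp add: mem_polyhedron_of)
          then show "b $ i \<le> B $ i \<bullet> z'"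
            using that by (simp add: z'_def inner_add_right inner_diff_right)
        qed
        ultimately show ?thesis using act[OF \<open>w \<in> F\<close>] by (auto simp: \<rho>'_def)
      qed
      ultimately show ?thesis by blast
    qed
  qed
qed

text \<open>In an irreducible exchange of \<open>x\<close> for \<open>y\<close>, the value of a constraint active at \<open>z\<close> increases from \<open>x\<close> to
  \<open>y\<close> by the sum of the slacks at the vertices, weighted by \<open>\<rho>\<close>. If the constraint is inactive at \<open>w\<close>, this
  is at least \<open>\<rho> w * \<zeta>\<close>, and it is at most \<open>\<phi> * norm (y - x)\<close>. Each unit of
  weight moved from the support to \<open>z\<close> lowers the linear function \<open>g\<close> by at most \<open>g \<bullet> (u - s)\<close>.\<close>

lemma pairwise_gap_bound:
  fixes B :: "real^'n^'m" and b :: "real^'m"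
  defines "X \<equiv> polyhedron_of B b"
  assumes X: "bounded X"
    and \<mu>: "\<And>w. w \<in> vertices X \<Longrightarrow> 0 \<le> \<mu> w" "(\<Sum>w\<in>vertices X. \<mu> w) = 1"
    and x: "x = (\<Sum>w\<in>vertices X. \<mu> w *\<^sub>R w)"
    and y: "y \<in> X" "y \<noteq> x"
    and u: "\<And>w. w \<in> support X \<mu> \<Longrightarrow> g \<bullet> w \<le> g \<bullet> u" and s: "\<And>z. z \<in> X \<Longrightarrow> g \<bullet> s \<le> g \<bullet> z"
    and us: "g \<bullet> s \<le> g \<bullet> u"
  shows "0 < Omega_geom B b"
    "Omega_geom B b / real (card (vertices X)) * (g \<bullet> (x - y)) \<le> (g \<bullet> (u - s)) * norm (x - y)"
proof -
  let ?V = "vertices X"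
  define Z where "Z = {b $ i - B $ i \<bullet> u | u i. u \<in> ?V \<and> b $ i > B $ i \<bullet> u}"
  define J where "J = UNIV - (\<Inter>u\<in>?V. active B b u)"
  have fin: "finite ?V" unfolding X_def by (rule finite_vertices_polyhedron_of)
  have "Z \<subseteq> (\<lambda>(u, i). b $ i - B $ i \<bullet> u) ` (?V \<times> UNIV)" by (auto simp: Z_def)
  then have finZ: "finite Z" by (rule finite_subset) (use fin in simp)
  obtain \<rho> z where z: "z \<in> X" and \<rho>: "\<And>w. w \<in> ?V \<Longrightarrow> 0 \<le> \<rho> w" "\<And>w. w \<in> ?V \<Longrightarrow> \<rho> w \<le> \<mu> w"
    and eq: "y - x = (\<Sum>w\<in>?V. \<rho> w *\<^sub>R (z - w))"
    and act: "\<And>w. w \<in> ?V \<Longrightarrow> \<rho> w = 0 \<or> (\<exists>i. B $ i \<bullet> z = b $ i \<and> B $ i \<bullet> w < b $ i)"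
    using irreducible_exchange[of B b ?V \<mu> x y ?V] assms(2-6) fin vertices_subset[of X]
    unfolding X_def by blast
  have bound: "0 < Omega_geom B b \<and> \<rho> w * Omega_geom B b \<le> norm (x - y)" if w: "w \<in> ?V" "\<rho> w \<noteq> 0" for w
  proof -
    obtain i where i: "B $ i \<bullet> z = b $ i" "B $ i \<bullet> w < b $ i" using act w by blast
    have "b $ i - B $ i \<bullet> w \<in> Z" using i(2) w(1) by (auto simp: Z_def)
    then have zle: "zeta B b \<le> b $ i - B $ i \<bullet> w" and "zeta B b \<in> Z"
      using finZ unfolding zeta_def Z_def[symmetric] X_def[symmetric] by (auto intro: Min_le Min_in)
    then have zpos: "0 < zeta B b" by (auto simp: Z_def)
    have "i \<in> J" using i(2) w(1) by (auto simp: J_def active_def intro!: bexI[of _ w])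
    then have ple: "norm (B $ i) \<le> phi B b"
      unfolding phi_def J_def[symmetric] X_def[symmetric] by (intro Max_ge) auto
    have "B $ i \<noteq> 0" using i by auto
    then have ppos: "0 < phi B b" using ple zero_less_norm_iff[of "B $ i"] by linarith
    have "\<rho> w * zeta B b \<le> \<rho> w * (b $ i - B $ i \<bullet> w)"
      using zle \<rho>(1) w(1) by (intro mult_left_mono) auto
    also have "\<dots> \<le> (\<Sum>w\<in>?V. \<rho> w * (b $ i - B $ i \<bullet> w))"
      using fin w(1) \<rho>(1) vertices_subset[of X]
      by (intro member_le_sum) (auto simp: X_def mem_polyhedron_of)
    also have "\<dots> = B $ i \<bullet> (y - x)"
      unfolding eq by (simp add: inner_sum_right inner_diff_right i(1))
    also have "\<dots> \<le> norm (B $ i) * norm (y - x)" by (rule norm_cauchy_schwarz)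
    also have "\<dots> \<le> phi B b * norm (x - y)"
      using ple by (simp add: mult_right_mono norm_minus_commute)
    finally show ?thesis
      using zpos ppos by (simp add: Omega_geom_def field_simps)
  qed
  have "\<exists>w\<in>?V. \<rho> w \<noteq> 0"
    using eq y(2) by (metis (no_types, lifting) eq_iff_diff_eq_0 scaleR_zero_left sum.neutral)
  then show \<Omega>: "0 < Omega_geom B b" using bound by blast
  have card: "0 < card ?V" using fin \<mu>(2) by (auto simp: card_gt_0_iff)
  have "g \<bullet> (x - y) = (\<Sum>w\<in>?V. \<rho> w * (g \<bullet> w - g \<bullet> z))"
  proof -
    have "x - y = - (y - x)" by simp
    then show ?thesis
      unfolding eq by (simp add: inner_sum_right inner_diff_right algebra_simps flip: sum_negf)
  qed
  also have "\<dots> \<le> (\<Sum>w\<in>?V. \<rho> w * (g \<bullet> (u - s)))"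
  proof (rule sum_mono)
    fix w assume w: "w \<in> ?V"
    show "\<rho> w * (g \<bullet> w - g \<bullet> z) \<le> \<rho> w * (g \<bullet> (u - s))"
    proof (cases "\<rho> w = 0")
      case False
      then have "w \<in> support X \<mu>" using w \<rho>[of w] by (auto simp: support_def)
      then show ?thesis
        using u[of w] s[OF z] \<rho>(1)[OF w] by (intro mult_left_mono) (auto simp: inner_diff_right)
    qed simp
  qed
  also have "\<dots> \<le> (\<Sum>w\<in>?V. norm (x - y) / Omega_geom B b * (g \<bullet> (u - s)))"
  proof (rule sum_mono)
    fix w assume w: "w \<in> ?V"
    have "\<rho> w \<le> norm (x - y) / Omega_geom B b"
      using bound[OF w] \<Omega> by (cases "\<rho> w = 0") (auto simp: pos_le_divide_eq)
    then show "\<rho> w * (g \<bullet> (u - s)) \<le> norm (x - y) / Omega_geom B b * (g \<bullet> (u - s))"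
      using us by (intro mult_right_mono) (auto simp: inner_diff_right)
  qed
  finally show "Omega_geom B b / real (card ?V) * (g \<bullet> (x - y)) \<le> (g \<bullet> (u - s)) * norm (x - y)"
    using \<Omega> card by (simp add: field_simps)
qed

section \<open>Generalized self-concordance along lines\<close>

abbreviation real_part :: "('a \<Rightarrow> ereal) \<Rightarrow> 'a \<Rightarrow> real" where
  "real_part f \<equiv> \<lambda>y. real_of_ereal (f y)"

definition hess_form :: "(real^'n \<Rightarrow> ereal) \<Rightarrow> real^'n \<Rightarrow> real^'n \<Rightarrow> real" where
  "hess_form f x v = (hess f x *v v) \<bullet> v"

lemma GSC_D:
  assumes "f \<in> GSC M \<nu>"
  shows "f x \<noteq> -\<infinity>" "lower_semicont f" "econvex f" "open (edom f)" "C3_on_edom f"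
    "x \<in> edom f \<Longrightarrow> \<bar>(third_deriv f x v *v u) \<bullet> u\<bar>
        \<le> M * (local_norm f x u)\<^sup>2 * rpow (local_norm f x v) (\<nu> - 2) * rpow (norm v) (3 - \<nu>)"
  using assms by (auto simp: GSC_def)

lemma GSC_ereal:
  assumes "f \<in> GSC M \<nu>" "x \<in> edom f"
  shows "f x = ereal (real_part f x)"
  using assms GSC_D(1)[OF assms(1), of x] by (cases "f x") (simp_all add: edom_def)

lemma GSC_le_ereal_iff:
  assumes "f \<in> GSC M \<nu>" "x \<in> edom f"
  shows "f x \<le> ereal c \<longleftrightarrow> real_part f x \<le> c"
  using GSC_ereal[OF assms] by (metis ereal_less_eq(3))

lemma GDERIV_grad:
  assumes "f \<in> GSC M \<nu>" "x \<in> edom f"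
  shows "GDERIV (real_part f) x :> grad f x"
proof -
  have "real_part f differentiable (at x)"
    using GSC_D(5)[OF assms(1)] assms(2) by (auto simp: C3_on_edom_def)
  then obtain F' where F': "(real_part f has_derivative F') (at x)"
    by (auto simp: differentiable_def)
  then interpret F': bounded_linear F' by (rule has_derivative_bounded_linear)
  define g where "g = (\<Sum>i\<in>Basis. F' i *\<^sub>R i)"
  have "F' h = h \<bullet> g" for h
  proof -
    have "F' h = F' (\<Sum>i\<in>Basis. (h \<bullet> i) *\<^sub>R i)" by (simp add: euclidean_representation)
    then show ?thesis by (simp add: F'.sum F'.scaleR g_def inner_sum_right mult.commute)
  qed
  then have g: "GDERIV (real_part f) x :> g"
    using F' unfolding gderiv_def by (metis (no_types, lifting) ext)
  have "g' = g" if "GDERIV (real_part f) x :> g'" for g'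
  proof -
    have "(\<lambda>h. h \<bullet> g') = (\<lambda>h. h \<bullet> g)"
      using that g unfolding gderiv_def by (rule has_derivative_unique)
    then have "\<forall>h. h \<bullet> g' = h \<bullet> g" by (metis (no_types))
    then show ?thesis by (simp only: vector_eq_ldot)
  qed
  then show ?thesis unfolding grad_def using g by (metis (mono_tags, lifting) theI)
qed

lemma grad_has_derivative:
  assumes "f \<in> GSC M \<nu>" "x \<in> edom f"
  shows "(grad f has_derivative (\<lambda>h. hess f x *v h)) (at x)"
  using GSC_D(5)[OF assms(1)] assms(2) unfolding C3_on_edom_def hess_def
  by (simp add: jacobian_works)

lemma hess_has_derivative:
  assumes "f \<in> GSC M \<nu>" "x \<in> edom f"
  shows "(hess f has_derivative third_deriv f x) (at x)"
proof -
  have "third_deriv f x = frechet_derivative (hess f) (at x)"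
    by (simp add: third_deriv_def fun_eq_iff)
  then show ?thesis
    using GSC_D(5)[OF assms(1)] assms(2) unfolding C3_on_edom_def
    by (simp add: frechet_derivative_works)
qed

lemma hess_symmetric:
  assumes "f \<in> GSC M \<nu>" "x \<in> edom f"
  shows "(hess f x *v u) \<bullet> w = (hess f x *v w) \<bullet> u"
  by (rule derivative_of_gradient_symmetric[OF GSC_D(4)[OF assms(1)] assms(2) GDERIV_grad[OF assms(1)]
        grad_has_derivative[OF assms]])

lemma line_has_derivative: "((\<lambda>s. x + s *\<^sub>R v) has_derivative (\<lambda>h. h *\<^sub>R v)) (at s)"
  by (auto intro!: derivative_eq_intros)

lemma DERIV_line:
  assumes "f \<in> GSC M \<nu>" "x + s *\<^sub>R v \<in> edom f"
  shows "((\<lambda>s. real_part f (x + s *\<^sub>R v)) has_real_derivative grad f (x + s *\<^sub>R v) \<bullet> v) (at s)"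
proof -
  have "((\<lambda>s. real_part f (x + s *\<^sub>R v)) has_derivative (\<lambda>h. (h *\<^sub>R v) \<bullet> grad f (x + s *\<^sub>R v))) (at s)"
    using has_derivative_compose[OF line_has_derivative GDERIV_grad[OF assms, unfolded gderiv_def]] .
  moreover have "(\<lambda>h. (h *\<^sub>R v) \<bullet> D) = (*) (D \<bullet> v)" for D
    by (simp add: fun_eq_iff inner_commute)
  ultimately show ?thesis by (simp add: has_field_derivative_def)
qed

lemma DERIV_line_grad:
  fixes f :: "real^'n \<Rightarrow> ereal"
  assumes "f \<in> GSC M \<nu>" "x + s *\<^sub>R v \<in> edom f"
  shows "((\<lambda>s. grad f (x + s *\<^sub>R v) \<bullet> v) has_real_derivative hess_form f (x + s *\<^sub>R v) v) (at s)"
proof -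
  have "((\<lambda>s. grad f (x + s *\<^sub>R v) \<bullet> v) has_derivative (\<lambda>h. (hess f (x + s *\<^sub>R v) *v (h *\<^sub>R v)) \<bullet> v)) (at s)"
    by (intro has_derivative_inner_left has_derivative_compose[OF line_has_derivative grad_has_derivative[OF assms]])
  moreover have "(\<lambda>h. (A *v (h *\<^sub>R v)) \<bullet> v) = (*) ((A *v v) \<bullet> v)" for A :: "real^'n^'n"
    by (simp add: fun_eq_iff matrix_vector_mult_scaleR)
  ultimately show ?thesis by (simp add: has_field_derivative_def hess_form_def)
qed

lemma DERIV_line_hess:
  fixes f :: "real^'n \<Rightarrow> ereal"
  assumes "f \<in> GSC M \<nu>" "x + s *\<^sub>R v \<in> edom f"
  shows "((\<lambda>s. hess_form f (x + s *\<^sub>R v) v) has_real_derivative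
    (third_deriv f (x + s *\<^sub>R v) v *v v) \<bullet> v) (at s)"
proof -
  have lin: "linear (\<lambda>A :: real^'n^'n. (A *v v) \<bullet> v)"
    by (intro linearI) (simp_all add: matrix_vector_mult_add_rdistrib inner_add_left flip: scaleR_matrix_vector_assoc)
  have D: "(hess f has_derivative third_deriv f (x + s *\<^sub>R v)) (at (x + s *\<^sub>R v))"
    by (rule hess_has_derivative[OF assms])
  have "((\<lambda>s. (hess f (x + s *\<^sub>R v) *v v) \<bullet> v) has_derivative
      (\<lambda>h. (third_deriv f (x + s *\<^sub>R v) (h *\<^sub>R v) *v v) \<bullet> v)) (at s)"
    using bounded_linear.has_derivative[OF linear_conv_bounded_linear[THEN iffD1, OF lin]
        has_derivative_compose[OF line_has_derivative D]] .
  moreover have "(\<lambda>h. (third_deriv f (x + s *\<^sub>R v) (h *\<^sub>R v) *v v) \<bullet> v)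
      = (*) ((third_deriv f (x + s *\<^sub>R v) v *v v) \<bullet> v)"
    using linear_scale[OF has_derivative_linear[OF D]]
    by (simp add: fun_eq_iff flip: scaleR_matrix_vector_assoc)
  ultimately show ?thesis by (simp add: has_field_derivative_def hess_form_def)
qed

text \<open>For \<open>\<nu> = 2\<close> the hypothesis bounds the derivative of \<open>ln q\<close>, and for \<open>\<nu> > 2\<close> that of
  \<open>q powr ((2 - \<nu>) / 2)\<close>, by a constant.\<close>

lemma hess_growth:
  fixes q q' :: "real \<Rightarrow> real"
  assumes \<nu>: "2 \<le> \<nu>" "\<nu> \<le> 3" and t: "0 \<le> t"
    and q: "\<And>s. 0 \<le> s \<Longrightarrow> s \<le> t \<Longrightarrow> 0 < q s"
    and D: "\<And>s. 0 \<le> s \<Longrightarrow> s \<le> t \<Longrightarrow> (q has_real_derivative q' s) (at s)"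
    and gsc: "\<And>s. 0 \<le> s \<Longrightarrow> s \<le> t \<Longrightarrow>
      \<bar>q' s\<bar> \<le> M * q s * rpow (sqrt (q s)) (\<nu> - 2) * rpow \<beta> (3 - \<nu>)"
    and \<beta>: "0 < \<beta>" and m: "m = M * delta \<nu> \<beta> (sqrt (q 0))" and dom: "growth_dom \<nu> (t * m)"
  shows "q t \<le> q 0 * growth \<nu> (t * m)"
proof (cases "\<nu> = 2")
  case True
  have "(\<lambda>s. m * s - ln (q s)) 0 \<le> (\<lambda>s. m * s - ln (q s)) t"
  proof (rule DERIV_nonneg_imp_nondecreasing[OF t])
    fix s assume s: "0 \<le> s" "s \<le> t"
    have "((\<lambda>s. m * s - ln (q s)) has_real_derivative m - q' s / q s) (at s)"
      using q[OF s] D[OF s] by (auto intro!: derivative_eq_intros)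
    moreover have "0 \<le> m - q' s / q s"
      using gsc[OF s] q[OF s] True \<beta> by (simp add: m delta_def rpow_def field_simps)
    ultimately show "\<exists>y. ((\<lambda>s. m * s - ln (q s)) has_real_derivative y) (at s) \<and> 0 \<le> y" by blast
  qed
  then have "ln (q t) \<le> ln (q 0) + t * m" by (simp add: mult.commute)
  also have "\<dots> = ln (q 0 * exp (t * m))" using q[of 0] t by (simp add: ln_mult)
  finally show ?thesis
    using True q[of 0] q[of t] t by (simp add: growth_def)
next
  case False
  then have \<nu>2: "2 < \<nu>" using \<nu> by simp
  define c where "c = (\<nu> - 2) / 2"
  define R where "R = M * rpow \<beta> (3 - \<nu>)"
  have c: "0 < c" using \<nu>2 by (simp add: c_def)
  have rp: "rpow (sqrt (q s)) (\<nu> - 2) = q s powr c" if "0 \<le> s" "s \<le> t" for s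
    using q[OF that] False by (simp add: rpow_def c_def powr_half_sqrt[symmetric] powr_powr)
  have mR: "m = c * R * q 0 powr c"
    using False rp[of 0] t by (simp add: m delta_def c_def R_def)
  have "(\<lambda>s. q s powr (- c) + c * R * s) 0 \<le> (\<lambda>s. q s powr (- c) + c * R * s) t"
  proof (rule DERIV_nonneg_imp_nondecreasing[OF t])
    fix s assume s: "0 \<le> s" "s \<le> t"
    have "((\<lambda>s. q s powr (- c) + c * R * s) has_real_derivative
        (- c) * q s powr (- c - 1) * q' s + c * R) (at s)"
      using q[OF s] D[OF s] by (auto intro!: derivative_eq_intros)
    moreover have "q s powr (- c - 1) * q' s \<le> R"
    proof -
      have "q s powr (- c - 1) * q' s \<le> q s powr (- c - 1) * (R * (q s * q s powr c))"
        using gsc[OF s] unfolding rp[OF s] by (intro mult_left_mono) (auto simp: R_def ac_simps)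
      also have "q s * q s powr c = q s powr (c + 1)"
        using q[OF s] by (simp add: powr_add)
      also have "q s powr (- c - 1) * (R * q s powr (c + 1)) = R * (q s powr (- c - 1 + (c + 1)))"
        unfolding powr_add by simp
      finally show ?thesis using q[OF s] by simp
    qed
    then have "c * (q s powr (- c - 1) * q' s) \<le> c * R"
      using c by (simp add: mult_left_mono)
    then have "0 \<le> (- c) * q s powr (- c - 1) * q' s + c * R"
      by (simp add: mult.assoc)
    ultimately show "\<exists>y. ((\<lambda>s. q s powr (- c) + c * R * s) has_real_derivative y) (at s) \<and> 0 \<le> y" by blast
  qed
  then have ge: "q 0 powr (- c) - c * R * t \<le> q t powr (- c)" by simp
  have q0: "0 < q 0" and qt: "0 < q t" using q t by auto
  have pos: "0 < 1 - t * m" using dom False by (simp add: growth_dom_def)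
  have "q 0 powr (- c) * (1 - t * m) = q 0 powr (- c) - c * R * t * (q 0 powr (- c) * q 0 powr c)"
    unfolding mR by (simp add: algebra_simps)
  also have "q 0 powr (- c) * q 0 powr c = 1"
    using q0 by (simp add: powr_minus)
  finally have le: "q 0 powr (- c) * (1 - t * m) \<le> q t powr (- c)" using ge by simp
  have "(q t powr (- c)) powr (- 1 / c) \<le> (q 0 powr (- c) * (1 - t * m)) powr (- 1 / c)"
    by (rule powr_mono2') (use c q0 pos le in auto)
  also have "\<dots> = (q 0 powr (- c)) powr (- 1 / c) * (1 - t * m) powr (- 1 / c)"
    by (rule powr_mult)
  also have "(q 0 powr (- c)) powr (- 1 / c) = q 0"
    using c q0 by (simp add: powr_powr)
  also have "(q t powr (- c)) powr (- 1 / c) = q t"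
    using c qt by (simp add: powr_powr)
  also have "- 1 / c = 2 / (2 - \<nu>)" using \<nu>2 by (simp add: c_def field_simps)
  finally show ?thesis using False by (simp add: growth_def)
qed

lemma local_norm_sq: "0 \<le> hess_form f x v \<Longrightarrow> (local_norm f x v)\<^sup>2 = hess_form f x v"
  by (simp add: local_norm_def hess_form_def)

text \<open>Both sides agree to first order at \<open>t = 0\<close>, and \<open>hess_growth\<close> orders their second derivatives.\<close>

lemma gsc_upper_bound_on_dom:
  assumes f: "f \<in> GSC M \<nu>" and \<nu>: "2 \<le> \<nu>" "\<nu> \<le> 3" and M: "0 \<le> M" and t: "0 \<le> t" and v: "v \<noteq> 0"
    and seg: "\<And>s. 0 \<le> s \<Longrightarrow> s \<le> t \<Longrightarrow> x + s *\<^sub>R v \<in> edom f"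
    and pos: "\<And>s. 0 \<le> s \<Longrightarrow> s \<le> t \<Longrightarrow> 0 < hess_form f (x + s *\<^sub>R v) v"
    and m: "m = M * delta \<nu> (norm v) (local_norm f x v)" and dom: "growth_dom \<nu> (t * m)"
  shows "real_part f (x + t *\<^sub>R v)
    \<le> real_part f x + t * (grad f x \<bullet> v) + (local_norm f x v)\<^sup>2 * gsc_quad \<nu> m t"
proof -
  define e2 where "e2 = (local_norm f x v)\<^sup>2"
  have e2: "e2 = hess_form f (x + 0 *\<^sub>R v) v"
    using pos[of 0] t by (simp add: e2_def local_norm_sq)
  have m0: "0 \<le> m"
    using M \<nu> by (auto simp: m delta_def rpow_def)
  have d: "growth_dom \<nu> (s * m)" if "s \<le> t" for s
    using growth_dom_le[OF dom] that m0 by (simp add: mult_right_mono)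
  have growth: "hess_form f (x + s *\<^sub>R v) v \<le> e2 * growth \<nu> (s * m)" if s: "0 \<le> s" "s \<le> t" for s
    unfolding e2
  proof (rule hess_growth[OF \<nu> s(1), where q' = "\<lambda>s. (third_deriv f (x + s *\<^sub>R v) v *v v) \<bullet> v" and \<beta> = "norm v" and M = M])
    fix r assume r: "0 \<le> r" "r \<le> s"
    then have r': "r \<le> t" using s by simp
    show "0 < hess_form f (x + r *\<^sub>R v) v" by (rule pos[OF r(1) r'])
    show "((\<lambda>s. hess_form f (x + s *\<^sub>R v) v) has_real_derivative (third_deriv f (x + r *\<^sub>R v) v *v v) \<bullet> v) (at r)"
      by (rule DERIV_line_hess[OF f seg[OF r(1) r']])
    show "\<bar>(third_deriv f (x + r *\<^sub>R v) v *v v) \<bullet> v\<bar> \<le> M * hess_form f (x + r *\<^sub>R v) v *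
        rpow (sqrt (hess_form f (x + r *\<^sub>R v) v)) (\<nu> - 2) * rpow (norm v) (3 - \<nu>)"
      using GSC_D(6)[OF f seg[OF r(1) r'], of v v] pos[OF r(1) r']
      by (simp add: local_norm_def hess_form_def)
  qed (use v d[OF s(2)] in \<open>auto simp: m local_norm_def hess_form_def\<close>)
  have "(\<lambda>s. e2 * gsc_quad \<nu> m s - real_part f (x + s *\<^sub>R v)) 0 +
      t * (\<lambda>s. e2 * gsc_quad' \<nu> m s - grad f (x + s *\<^sub>R v) \<bullet> v) 0
      \<le> (\<lambda>s. e2 * gsc_quad \<nu> m s - real_part f (x + s *\<^sub>R v)) t"
  proof (rule second_order_bound[OF t, where ?F2.0 = "\<lambda>s. e2 * growth \<nu> (s * m) - hess_form f (x + s *\<^sub>R v) v"])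
    fix s assume s: "0 \<le> s" "s \<le> t"
    show "((\<lambda>s. e2 * gsc_quad \<nu> m s - real_part f (x + s *\<^sub>R v)) has_real_derivative
        e2 * gsc_quad' \<nu> m s - grad f (x + s *\<^sub>R v) \<bullet> v) (at s)"
      by (intro DERIV_diff DERIV_cmult DERIV_gsc_quad DERIV_line[OF f] \<nu> d seg s)
    show "((\<lambda>s. e2 * gsc_quad' \<nu> m s - grad f (x + s *\<^sub>R v) \<bullet> v) has_real_derivative
        e2 * growth \<nu> (s * m) - hess_form f (x + s *\<^sub>R v) v) (at s)"
      by (intro DERIV_diff DERIV_cmult DERIV_gsc_quad' DERIV_line_grad[OF f] \<nu> d seg s)
    show "0 \<le> e2 * growth \<nu> (s * m) - hess_form f (x + s *\<^sub>R v) v"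
      using growth[OF s] by simp
  qed
  then show ?thesis by (simp add: e2_def)
qed

text \<open>Limits along \<open>at x\<close> exclude \<open>x\<close> itself, so a neighbourhood is obtained by adding this point.\<close>

lemma closed_sublevel:
  assumes "lower_semicont f"
  shows "closed {y. f y \<le> c}"
proof -
  have "open {y. c < f y}"
  proof (subst open_subopen, clarify)
    fix y assume y: "c < f y"
    then have "c < Liminf (at y) f"
      using assms less_le_trans unfolding lower_semicont_def by blast
    then have "eventually (\<lambda>z. c < f z) (at y)" by (rule less_LiminfD)
    then obtain S where "open S" "y \<in> S" "\<forall>z\<in>S. z \<noteq> y \<longrightarrow> c < f z"
      unfolding eventually_at_topological by auto
    then show "\<exists>T. open T \<and> y \<in> T \<and> T \<subseteq> {y. c < f y}"
      using y by (intro exI[of _ S]) auto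
  qed
  moreover have "{y. f y \<le> c} = - {y. c < f y}" by auto
  ultimately show ?thesis by (simp add: closed_def)
qed

lemma econvex_sublevel:
  assumes "econvex f" "f x \<le> ereal c" "f y \<le> ereal c" "0 \<le> t" "t \<le> 1"
  shows "f ((1 - t) *\<^sub>R x + t *\<^sub>R y) \<le> ereal c"
proof (cases "t = 0 \<or> t = 1")
  case False
  then have "f ((1 - t) *\<^sub>R x + t *\<^sub>R y) \<le> ereal (1 - t) * f x + ereal t * f y"
    using assms unfolding econvex_def by simp
  also have "\<dots> \<le> ereal (1 - t) * ereal c + ereal t * ereal c"
    by (intro add_mono ereal_mult_left_mono) (use assms in auto)
  also have "\<dots> = ereal ((1 - t) * c + t * c)" by simp
  also have "(1 - t) * c + t * c = c" by (simp add: left_diff_distrib)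
  finally show ?thesis .
qed (use assms in auto)

lemma edom_segment:
  assumes "f \<in> GSC M \<nu>" "x \<in> edom f" "x + t *\<^sub>R v \<in> edom f" "0 \<le> s" "s \<le> t"
  shows "x + s *\<^sub>R v \<in> edom f"
proof (cases "t = 0")
  case False
  then have t: "0 < t" using assms by simp
  define c where "c = max (real_part f x) (real_part f (x + t *\<^sub>R v))"
  have "f ((1 - s / t) *\<^sub>R x + (s / t) *\<^sub>R (x + t *\<^sub>R v)) \<le> ereal c"
  proof (rule econvex_sublevel[OF GSC_D(3)[OF assms(1)]])
    show "f x \<le> ereal c"
      unfolding GSC_le_ereal_iff[OF assms(1,2)] c_def by (rule max.cobounded1)
    show "f (x + t *\<^sub>R v) \<le> ereal c"
      unfolding GSC_le_ereal_iff[OF assms(1,3)] c_def by (rule max.cobounded2)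
  qed (use t assms(4,5) in simp_all)
  also have "(1 - s / t) *\<^sub>R x + (s / t) *\<^sub>R (x + t *\<^sub>R v) = x + s *\<^sub>R v"
    using t by (simp add: scaleR_left_diff_distrib scaleR_right_distrib)
  finally show ?thesis by (auto simp: edom_def)
qed (use assms in simp)

text \<open>The parameters whose points lie in the domain form an open subset of \<open>{0..t}\<close>. The upper bound,
  valid as long as the segment stays in the domain, keeps \<open>f\<close> bounded on it, so by lower
  semicontinuity the subset is also closed; hence it is all of \<open>{0..t}\<close>.\<close>

lemma gsc_upper_bound:
  assumes f: "f \<in> GSC M \<nu>" and \<nu>: "2 \<le> \<nu>" "\<nu> \<le> 3" and M: "0 \<le> M" and t: "0 \<le> t" and v: "v \<noteq> 0"
    and x: "x \<in> edom f"
    and pos: "\<And>s. 0 \<le> s \<Longrightarrow> s \<le> t \<Longrightarrow> x + s *\<^sub>R v \<in> edom f \<Longrightarrow> 0 < hess_form f (x + s *\<^sub>R v) v"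
    and m: "m = M * delta \<nu> (norm v) (local_norm f x v)" and dom: "growth_dom \<nu> (t * m)"
  shows "x + t *\<^sub>R v \<in> edom f" and "real_part f (x + t *\<^sub>R v)
    \<le> real_part f x + t * (grad f x \<bullet> v) + (local_norm f x v)\<^sup>2 * gsc_quad \<nu> m t"
proof -
  define U where "U s = real_part f x + s * (grad f x \<bullet> v) + (local_norm f x v)\<^sup>2 * gsc_quad \<nu> m s" for s
  have m0: "0 \<le> m"
    using M \<nu> by (auto simp: m delta_def rpow_def)
  have d: "growth_dom \<nu> (s * m)" if "s \<le> t" for s
    using growth_dom_le[OF dom] that m0 by (simp add: mult_right_mono)
  have bound: "real_part f (x + s *\<^sub>R v) \<le> U s" if s: "0 \<le> s" "s \<le> t" "x + s *\<^sub>R v \<in> edom f" for s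
    unfolding U_def
    by (rule gsc_upper_bound_on_dom[OF f \<nu> M s(1) v _ _ m d[OF s(2)]])
       (use edom_segment[OF f x s(3)] pos s(2) in auto)
  have "continuous_on {0..t} (gsc_quad \<nu> m)"
    using DERIV_isCont[OF DERIV_gsc_quad[OF \<nu> d]] by (simp add: continuous_at_imp_continuous_on)
  then have "continuous_on {0..t} U"
    unfolding U_def by (intro continuous_intros)
  then obtain K where K: "\<And>s. s \<in> {0..t} \<Longrightarrow> U s \<le> K"
    using continuous_attains_sup[of "{0..t}" U] t by fastforce
  define T where "T = {s \<in> {0..t}. x + s *\<^sub>R v \<in> edom f}"
  have "T = {0..t} \<inter> (\<lambda>s. x + s *\<^sub>R v) -` edom f" by (auto simp: T_def)
  moreover have "open ((\<lambda>s. x + s *\<^sub>R v) -` edom f)"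
    by (intro continuous_open_vimage GSC_D(4)[OF f]) (auto intro!: continuous_intros)
  ultimately have op: "openin (top_of_set {0..t}) T" by (simp only: openin_open_Int)
  have "T = {0..t} \<inter> (\<lambda>s. x + s *\<^sub>R v) -` {y. f y \<le> ereal K}"
  proof -
    have "f (x + s *\<^sub>R v) \<le> ereal K" if "s \<in> T" for s
      using that bound[of s] K[of s] GSC_le_ereal_iff[OF f, of "x + s *\<^sub>R v" K] by (auto simp: T_def)
    moreover have "x + s *\<^sub>R v \<in> edom f" if "f (x + s *\<^sub>R v) \<le> ereal K" for s
      using that by (auto simp: edom_def)
    ultimately show ?thesis by (auto simp: T_def)
  qed
  moreover have "closed ((\<lambda>s. x + s *\<^sub>R v) -` {y. f y \<le> ereal K})"
    by (intro continuous_closed_vimage closed_sublevel GSC_D(2)[OF f]) (auto intro!: continuous_intros)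
  ultimately have cl: "closedin (top_of_set {0..t}) T" by (simp only: closedin_closed_Int)
  have "0 \<in> T" using x t by (simp add: T_def)
  have "connected {0..t}" by simp
  then have "T = {} \<or> T = {0..t}"
    unfolding connected_clopen using op cl by blast
  then have "T = {0..t}" using \<open>0 \<in> T\<close> by blast
  then have "t \<in> T" using t by simp
  then show *: "x + t *\<^sub>R v \<in> edom f" by (simp add: T_def)
  show "real_part f (x + t *\<^sub>R v)
    \<le> real_part f x + t * (grad f x \<bullet> v) + (local_norm f x v)\<^sup>2 * gsc_quad \<nu> m t"
    using bound[OF t order_refl *] by (simp add: U_def)
qed

lemma step_model_eq:
  assumes "2 \<le> \<nu>" "\<nu> \<le> 3" "m = M * delta \<nu> (norm v) (local_norm f x v)" "growth_dom \<nu> (t * m)"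
  shows "step_model f M \<nu> x v t = ereal (t * (grad f x \<bullet> v) + (local_norm f x v)\<^sup>2 * gsc_quad \<nu> m t)"
proof -
  have eq: "t * M * delta \<nu> (norm v) (local_norm f x v) = t * m" by (simp add: assms(3))
  show ?thesis
    unfolding step_model_def Let_def gsc_quad_def eq
    using omega_eq_ereal[OF assms(1,2), of "t * m"] assms(4)
    by (simp add: ac_simps)
qed

text \<open>The local norm has to be nonzero because \<open>0 * \<infinity> = 0\<close> in the extended reals.\<close>

lemma step_model_infinite:
  assumes "2 \<le> \<nu>" "\<nu> \<le> 3" "m = M * delta \<nu> (norm v) (local_norm f x v)" "\<not> growth_dom \<nu> (t * m)"
    "t \<noteq> 0" "local_norm f x v \<noteq> 0"
  shows "step_model f M \<nu> x v t = \<infinity>"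
proof -
  have "t * m \<noteq> 0" using assms(4) by (auto simp: growth_dom_def)
  moreover have eq: "t * M * delta \<nu> (norm v) (local_norm f x v) = t * m" by (simp add: assms(3))
  ultimately show ?thesis
    unfolding step_model_def Let_def eq
    using omega_eq_ereal[OF assms(1,2), of "t * m"] assms(4-6) by simp
qed

section \<open>Curvature on the initial sublevel set\<close>

lemma compact_sublevel:
  assumes f: "f \<in> GSC M \<nu>" and "compact X" and x0: "x0 \<in> edom f"
  shows "compact (sublevel f X x0)"
proof -
  have "sublevel f X x0 = X \<inter> {y. f y \<le> f x0}"
    using x0 by (auto simp: sublevel_def edom_def)
  then show ?thesis
    using assms(2) closed_sublevel[OF GSC_D(2)[OF f]] by (simp add: compact_Int_closed)
qed

text \<open>A crude bound suffices: it only serves to show that the supremum defining \<open>L_grad\<close> is finite.\<close>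

lemma eigenvalue_le_norm:
  fixes A :: "real^'n^'n"
  assumes "l \<in> eigenvalues A"
  shows "l \<le> real CARD('n) * real CARD('n) * norm A"
proof -
  obtain v where v: "v \<noteq> 0" "A *v v = l *\<^sub>R v" using assms by (auto simp: eigenvalues_def)
  have "\<bar>A $ i $ j\<bar> \<le> norm A" for i j
    using component_le_norm_cart[of "A $ i" j] Finite_Cartesian_Product.norm_nth_le[of A i] by linarith
  then have "onorm ((*v) A) \<le> real CARD('n) * real CARD('n) * norm A"
    by (rule onorm_le_matrix_component)
  then have "onorm ((*v) A) * norm v \<le> real CARD('n) * real CARD('n) * norm A * norm v"
    by (rule mult_right_mono) simp
  with onorm[OF matrix_vector_mul_bounded_linear, of A v]
  have "norm (A *v v) \<le> real CARD('n) * real CARD('n) * norm A * norm v"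
    by (rule order_trans)
  then have "\<bar>l\<bar> \<le> real CARD('n) * real CARD('n) * norm A"
    using v(1) unfolding v(2) by simp
  then show ?thesis by simp
qed

text \<open>Suprema and infima of real sets are meaningful only for bounded sets. The infimum \<open>sigma_min\<close> is over
  positive numbers; for the supremum \<open>L_grad\<close>, boundedness comes from compactness of the sublevel set
  and continuity of the Hessian.\<close>

lemma hess_form_bounds:
  assumes f: "f \<in> GSC M \<nu>" and X: "compact X" and x0: "x0 \<in> edom f"
    and cont: "continuous_on (X \<inter> edom f) (hess f)"
    and pos: "\<And>y w. y \<in> X \<inter> edom f \<Longrightarrow> w \<noteq> 0 \<Longrightarrow> 0 < hess_form f y w"
    and y: "y \<in> sublevel f X x0"
  shows "sigma_min f X x0 * (norm v)\<^sup>2 \<le> hess_form f y v"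
    and "hess_form f y v \<le> L_grad f X x0 * (norm v)\<^sup>2"
    and "0 \<le> sigma_min f X x0"
proof -
  let ?S = "sublevel f X x0"
  have sub: "?S \<subseteq> X \<inter> edom f" by (auto simp: sublevel_def)
  have dom: "z \<in> edom f" if "z \<in> ?S" for z using that sub by auto
  have sym: "(hess f z *v u) \<bullet> w = (hess f z *v w) \<bullet> u" if "z \<in> ?S" for z u w
    by (rule hess_symmetric[OF f dom[OF that]])
  have "0 \<le> l" if l: "l \<in> eigenvalues (hess f z)" "z \<in> ?S" for l z
  proof -
    obtain w where w: "w \<noteq> 0" "hess f z *v w = l *\<^sub>R w" using l(1) by (auto simp: eigenvalues_def)
    then have "0 < l * (w \<bullet> w)" using pos[of z w] sub l(2) by (auto simp: hess_form_def)
    moreover have "0 < w \<bullet> w" using w(1) by simp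
    ultimately show ?thesis by (metis less_imp_le zero_less_mult_pos2)
  qed
  then have low: "0 \<le> lambda_min (hess f z)" if "z \<in> ?S" for z
    using lambda_bounds(3)[OF sym[OF that]] that by blast
  show "0 \<le> sigma_min f X x0"
    unfolding sigma_min_def using y low by (intro cINF_greatest) auto
  have "bdd_below ((\<lambda>z. lambda_min (hess f z)) ` ?S)"
    using low by (auto intro!: bdd_belowI[of _ 0])
  then have "sigma_min f X x0 \<le> lambda_min (hess f y)"
    unfolding sigma_min_def using y by (rule cINF_lower)
  then show "sigma_min f X x0 * (norm v)\<^sup>2 \<le> hess_form f y v"
    using order_trans[OF mult_right_mono lambda_bounds(1)[OF sym[OF y], of v]]
    by (simp add: hess_form_def power2_norm_eq_inner)
  have "compact (hess f ` ?S)"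
    by (intro compact_continuous_image compact_sublevel[OF f X x0] continuous_on_subset[OF cont] sub)
  then have "bounded (hess f ` ?S)" by (rule compact_imp_bounded)
  then obtain K where K: "\<And>z. z \<in> ?S \<Longrightarrow> norm (hess f z) \<le> K"
    unfolding bounded_iff by blast
  have "lambda_max (hess f z) \<le> real CARD('a) * real CARD('a) * K" if "z \<in> ?S" for z
  proof -
    have "lambda_max (hess f z) \<le> real CARD('a) * real CARD('a) * norm (hess f z)"
      by (rule eigenvalue_le_norm[OF lambda_bounds(4)[OF sym[OF that]]])
    also have "\<dots> \<le> real CARD('a) * real CARD('a) * K"
      using K[OF that] by (intro mult_left_mono) auto
    finally show ?thesis .
  qed
  then have "bdd_above ((\<lambda>z. lambda_max (hess f z)) ` ?S)"
    by (auto intro!: bdd_aboveI)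
  then have "lambda_max (hess f y) \<le> L_grad f X x0"
    unfolding L_grad_def using y by (intro cSUP_upper)
  then show "hess_form f y v \<le> L_grad f X x0 * (norm v)\<^sup>2"
    using order_trans[OF lambda_bounds(2)[OF sym[OF y], of v] mult_right_mono]
    by (simp add: hess_form_def power2_norm_eq_inner)
qed

text \<open>By convexity the whole segment from \<open>x\<close> to \<open>y\<close> lies in the sublevel set, where the second derivative
  along it is bounded below.\<close>

lemma strong_convexity_on_sublevel:
  assumes f: "f \<in> GSC M \<nu>" and X: "compact X" "convex X" and x0: "x0 \<in> edom f"
    and cont: "continuous_on (X \<inter> edom f) (hess f)"
    and pos: "\<And>y w. y \<in> X \<inter> edom f \<Longrightarrow> w \<noteq> 0 \<Longrightarrow> 0 < hess_form f y w"
    and x: "x \<in> sublevel f X x0" and y: "y \<in> sublevel f X x0"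
  shows "real_part f x + grad f x \<bullet> (y - x) + sigma_min f X x0 / 2 * (norm (y - x))\<^sup>2 \<le> real_part f y"
proof -
  define v where "v = y - x"
  define c where "c = sigma_min f X x0 * (norm v)\<^sup>2"
  have seg: "x + s *\<^sub>R v \<in> sublevel f X x0" if "0 \<le> s" "s \<le> 1" for s
  proof -
    have eq: "x + s *\<^sub>R v = (1 - s) *\<^sub>R x + s *\<^sub>R y" by (simp add: v_def algebra_simps)
    have "x + s *\<^sub>R v \<in> X"
      unfolding eq using X(2) x y that by (auto simp: convex_alt sublevel_def)
    moreover have "f (x + s *\<^sub>R v) \<le> ereal (real_part f x0)"
      unfolding eq
      by (rule econvex_sublevel[OF GSC_D(3)[OF f] _ _ that])
         (use x y in \<open>auto simp: sublevel_def GSC_ereal[OF f x0, symmetric]\<close>)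
    ultimately show ?thesis
      unfolding GSC_ereal[OF f x0, symmetric] using x0 by (auto simp: sublevel_def edom_def)
  qed
  then have dom: "x + s *\<^sub>R v \<in> edom f" if "0 \<le> s" "s \<le> 1" for s
    using that by (auto simp: sublevel_def)
  have "(\<lambda>s. real_part f (x + s *\<^sub>R v) - c / 2 * s\<^sup>2) 0 + 1 * (\<lambda>s. grad f (x + s *\<^sub>R v) \<bullet> v - c * s) 0
      \<le> (\<lambda>s. real_part f (x + s *\<^sub>R v) - c / 2 * s\<^sup>2) 1"
  proof (rule second_order_bound[where ?F2.0 = "\<lambda>s. hess_form f (x + s *\<^sub>R v) v - c"])
    fix s :: real assume s: "0 \<le> s" "s \<le> 1"
    have "((\<lambda>s. c / 2 * s\<^sup>2) has_real_derivative c * s) (at s)"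
      by (auto intro!: derivative_eq_intros)
    then show "((\<lambda>s. real_part f (x + s *\<^sub>R v) - c / 2 * s\<^sup>2) has_real_derivative
        grad f (x + s *\<^sub>R v) \<bullet> v - c * s) (at s)"
      by (intro DERIV_diff DERIV_line[OF f dom[OF s]])
    have "((\<lambda>s. c * s) has_real_derivative c) (at s)"
      by (auto intro!: derivative_eq_intros)
    then show "((\<lambda>s. grad f (x + s *\<^sub>R v) \<bullet> v - c * s) has_real_derivative
        hess_form f (x + s *\<^sub>R v) v - c) (at s)"
      by (intro DERIV_diff DERIV_line_grad[OF f dom[OF s]])
    show "0 \<le> hess_form f (x + s *\<^sub>R v) v - c"
      using hess_form_bounds(1)[OF f X(1) x0 cont pos seg[OF s], of v] by (simp add: c_def)
  qed simp
  then show ?thesis by (simp add: c_def v_def)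
qed

section \<open>One line search\<close>

text \<open>One exact minimization of the step model over \<open>[0, tmax]\<close>. It covers both kinds of steps, which differ
  only in the direction and in the maximal length.\<close>

locale line_search =
  fixes f :: "real^'n \<Rightarrow> ereal" and M \<nu> :: real and X :: "(real^'n) set"
    and x v :: "real^'n" and tmax \<alpha> :: real
  assumes f: "f \<in> GSC M \<nu>" and \<nu>: "2 \<le> \<nu>" "\<nu> \<le> 3" and M: "0 \<le> M"
    and X: "convex X"
    and pos: "\<And>y w. y \<in> X \<inter> edom f \<Longrightarrow> w \<noteq> 0 \<Longrightarrow> 0 < hess_form f y w"
    and x: "x \<in> X" "x \<in> edom f" and tmax: "0 \<le> tmax" "x + tmax *\<^sub>R v \<in> X"
    and \<alpha>: "is_arg_min (step_model f M \<nu> x v) (\<lambda>t. t \<in> {0..tmax}) \<alpha>"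
begin

definition "slope = - (grad f x \<bullet> v)"

definition "curv = local_norm f x v"

definition "sc_scale = M * delta \<nu> (norm v) curv"

definition "model t = (local_norm f x v)\<^sup>2 * gsc_quad \<nu> sc_scale t - t * slope"

lemma \<alpha>_range: "0 \<le> \<alpha>" "\<alpha> \<le> tmax"
  using \<alpha> by (auto simp: is_arg_min_def)

lemma segment_in_X:
  assumes "0 \<le> t" "t \<le> tmax"
  shows "x + t *\<^sub>R v \<in> X"
proof (cases "tmax = 0")
  case False
  then have "x + t *\<^sub>R v = (1 - t / tmax) *\<^sub>R x + (t / tmax) *\<^sub>R (x + tmax *\<^sub>R v)"
    by (simp add: scaleR_left_diff_distrib scaleR_right_distrib)
  also have "\<dots> \<in> X"
    by (rule convexD[OF X x(1) tmax(2)]) (use assms False in auto)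
  finally show ?thesis .
qed (use assms x in auto)

lemma curv_pos: "v \<noteq> 0 \<Longrightarrow> 0 < curv"
  using pos[of x v] x by (simp add: curv_def local_norm_def hess_form_def)

lemma sc_scale_nonneg: "0 \<le> sc_scale"
  using M \<nu> by (auto simp: sc_scale_def delta_def rpow_def)

lemma sc_scale_eq: "sc_scale = M * delta \<nu> (norm v) (local_norm f x v)"
  by (simp add: sc_scale_def curv_def)

lemma step_model_model:
  "growth_dom \<nu> (t * sc_scale) \<Longrightarrow> step_model f M \<nu> x v t = ereal (model t)"
  by (subst step_model_eq[OF \<nu> sc_scale_eq]) (auto simp: model_def slope_def)

lemma model_\<alpha>_le:
  assumes "0 \<le> t" "t \<le> tmax"
  shows "step_model f M \<nu> x v \<alpha> \<le> step_model f M \<nu> x v t"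
  using \<alpha> assms by (auto simp: is_arg_min_linorder)

lemma growth_dom_\<alpha>:
  assumes "v \<noteq> 0"
  shows "growth_dom \<nu> (\<alpha> * sc_scale)"
proof (rule ccontr)
  assume nd: "\<not> growth_dom \<nu> (\<alpha> * sc_scale)"
  then have "\<alpha> \<noteq> 0" by (auto simp: growth_dom_def)
  then have "step_model f M \<nu> x v \<alpha> = \<infinity>"
    using step_model_infinite[OF \<nu> sc_scale_eq nd] curv_pos[OF assms] by (simp add: curv_def)
  moreover have "step_model f M \<nu> x v \<alpha> \<le> ereal (model 0)"
    using model_\<alpha>_le[of 0] tmax(1) step_model_model[of 0] by (simp add: growth_dom_def)
  ultimately show False by simp
qed

text \<open>The minimizer is compared with any competitor \<open>t\<close>; choosing \<open>t = 0\<close> shows that \<open>f\<close> does not increase.\<close>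

lemma decrease_ge_model:
  assumes "0 \<le> t" "t \<le> tmax" "growth_dom \<nu> (t * sc_scale)"
  shows "x + \<alpha> *\<^sub>R v \<in> edom f" "- model t \<le> real_part f x - real_part f (x + \<alpha> *\<^sub>R v)"
proof -
  have "x + \<alpha> *\<^sub>R v \<in> edom f \<and> - model t \<le> real_part f x - real_part f (x + \<alpha> *\<^sub>R v)"
  proof (cases "v = 0")
    case True
    have "model t = 0" unfolding model_def slope_def local_norm_def using True by simp
    then show ?thesis using x True by simp
  next
    case False
    note d = growth_dom_\<alpha>[OF False]
    have le: "model \<alpha> \<le> model t"
      using model_\<alpha>_le[OF assms(1,2)] step_model_model[OF d] step_model_model[OF assms(3)] by simp
    have p: "0 < hess_form f (x + s *\<^sub>R v) v" if "0 \<le> s" "s \<le> \<alpha>" "x + s *\<^sub>R v \<in> edom f" for s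
      using pos[of "x + s *\<^sub>R v" v] segment_in_X[of s] that \<alpha>_range False by auto
    show ?thesis
      using gsc_upper_bound[OF f \<nu> M \<alpha>_range(1) False x(2) p sc_scale_eq d] le
      by (auto simp: model_def slope_def)
  qed
  then show "x + \<alpha> *\<^sub>R v \<in> edom f" "- model t \<le> real_part f x - real_part f (x + \<alpha> *\<^sub>R v)" by auto
qed

lemma decrease_nonneg:
  "x + \<alpha> *\<^sub>R v \<in> edom f" "real_part f (x + \<alpha> *\<^sub>R v) \<le> real_part f x"
  using decrease_ge_model[of 0] tmax(1) by (auto simp: growth_dom_def model_def)

lemma convex_model:
  assumes "growth_dom \<nu> (t * sc_scale)"
  shows "convex_on {0..t} model"
proof -
  have "convex_on {0..t} (gsc_quad \<nu> sc_scale)"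
  proof (rule convex_on_subset[OF convex_on_gsc_quad[OF \<nu> sc_scale_nonneg]])
    have "growth_dom \<nu> (s * sc_scale)" if "s \<le> t" for s
      by (rule growth_dom_le[OF assms mult_right_mono[OF that sc_scale_nonneg]])
    then show "{0..t} \<subseteq> {t. 0 \<le> t \<and> growth_dom \<nu> (t * sc_scale)}" by auto
  qed simp
  moreover have "convex_on {0..t} (\<lambda>s. - slope * s)"
    by (rule convex_onI) (auto simp: algebra_simps)
  moreover from calculation(1)
  have "convex_on {0..t} (\<lambda>s. (local_norm f x v)\<^sup>2 * gsc_quad \<nu> sc_scale s)"
    by (intro convex_on_cmul) auto
  ultimately have "convex_on {0..t} (\<lambda>s. (local_norm f x v)\<^sup>2 * gsc_quad \<nu> sc_scale s + - slope * s)"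
    by (intro convex_on_add)
  then show ?thesis
    by (simp add: model_def[abs_def] mult.commute)
qed

text \<open>The trial step of \<open>model_decrease\<close> may be longer than \<open>tmax\<close>. If \<open>tmax \<ge> 1\<close>, the step of length \<open>1\<close> is an
  admissible competitor. If the search stopped before \<open>tmax\<close>, convexity makes its minimizer
  a minimizer of the model over longer steps as well.\<close>

lemma decrease:
  assumes G: "0 < slope" and full: "\<alpha> < tmax \<or> 1 \<le> tmax"
  defines "d \<equiv> real_part f x - real_part f (x + \<alpha> *\<^sub>R v)"
  shows "(0 < sc_scale \<and> rate_lin \<nu> * slope / sc_scale \<le> d) \<or> rate_quad \<nu> * slope\<^sup>2 / curv\<^sup>2 \<le> d \<or> slope / 2 \<le> d"
proof -
  have v: "v \<noteq> 0" using G by (auto simp: slope_def)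
  obtain t where t: "0 < t" "growth_dom \<nu> (t * sc_scale)"
    and best: "(0 < sc_scale \<and> rate_lin \<nu> * slope / sc_scale \<le> - model t) \<or> rate_quad \<nu> * slope\<^sup>2 / curv\<^sup>2 \<le> - model t"
    and half: "\<And>t'. 0 \<le> t' \<Longrightarrow> t' \<le> t \<Longrightarrow> t' * slope / 2 \<le> - model t'"
    using model_decrease[OF \<nu> sc_scale_nonneg curv_pos[OF v] G] by (auto simp: model_def curv_def)
  have d: "- model t' \<le> d" if "0 \<le> t'" "t' \<le> tmax" "growth_dom \<nu> (t' * sc_scale)" for t'
    unfolding d_def by (rule decrease_ge_model(2)[OF that])
  have dom: "growth_dom \<nu> (t' * sc_scale)" if "t' \<le> t" for t'
    using growth_dom_le[OF t(2)] that sc_scale_nonneg by (simp add: mult_right_mono)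
  consider "t \<le> tmax" | "tmax < t" "1 \<le> tmax" | "tmax < t" "\<alpha> < tmax" using full by linarith
  then show ?thesis
  proof cases
    case 1
    then show ?thesis using d[of t] t best by force
  next
    case 2
    then have "slope / 2 \<le> - model 1" using half[of 1] by simp
    then show ?thesis using d[of 1] 2 dom[of 1] by simp
  next
    case 3
    \<comment> \<open>\<open>tmax\<close> lies strictly between \<open>\<alpha>\<close> and \<open>t\<close>, with weight \<open>l\<close> on \<open>t\<close>.\<close>
    define l where "l = (tmax - \<alpha>) / (t - \<alpha>)"
    have l: "0 < l" "l \<le> 1" using 3 by (simp_all add: l_def)
    have "model ((1 - l) *\<^sub>R \<alpha> + l *\<^sub>R t) \<le> (1 - l) * model \<alpha> + l * model t"
      using convex_onD[OF convex_model[OF t(2)], of l \<alpha> t] l \<alpha>_range 3 t by simp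
    moreover have "(1 - l) *\<^sub>R \<alpha> + l *\<^sub>R t = tmax"
    proof -
      have "l * (t - \<alpha>) = tmax - \<alpha>" using 3 by (simp add: l_def)
      then show ?thesis by (simp add: algebra_simps)
    qed
    moreover have "model \<alpha> \<le> model tmax"
      using model_\<alpha>_le[of tmax] tmax(1) step_model_model[OF growth_dom_\<alpha>[OF v]] step_model_model[OF dom[of tmax]] 3
      by simp
    ultimately have "l * model \<alpha> \<le> l * model t" by (simp add: algebra_simps)
    then have "model \<alpha> \<le> model t" using l by simp
    moreover have "- model \<alpha> \<le> d" using d[OF \<alpha>_range growth_dom_\<alpha>[OF v]] .
    ultimately have "- model t \<le> d" by simp
    then show ?thesis using best by linarith
  qed
qed

end

section \<open>The constants of the rate\<close>

text \<open>For \<open>\<nu> > 2\<close>, inserting \<open>e \<le> sqrt L * \<beta>\<close> makes \<open>\<delta>\<close> linear in \<open>\<beta>\<close>.\<close>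

lemma delta_le:
  assumes \<nu>: "2 \<le> \<nu>" "\<nu> \<le> 3" and \<beta>: "0 < \<beta>" "\<beta> \<le> D" and e: "0 < e" "e \<le> sqrt L * \<beta>" and L: "0 < L"
  shows "delta \<nu> \<beta> e \<le> (if \<nu> = 2 then D else if \<nu> = 3 then sqrt L * D / 2
    else D * (\<nu> / 2 - 1) * L powr ((\<nu> - 2) / 2))"
proof -
  consider "\<nu> = 2" | "\<nu> = 3" | "2 < \<nu>" "\<nu> < 3" using \<nu> by linarith
  then show ?thesis
  proof cases
    case 1
    then show ?thesis using \<beta> by (simp add: delta_def)
  next
    case 2
    have "sqrt L * \<beta> \<le> sqrt L * D" using \<beta>(2) L by simp
    then have "e \<le> sqrt L * D" using e(2) by simp
    then show ?thesis using 2 e by (simp add: delta_def rpow_def)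
  next
    case 3
    have "e powr (\<nu> - 2) \<le> (sqrt L * \<beta>) powr (\<nu> - 2)"
      using e 3 by (intro powr_mono2) auto
    also have "\<dots> = L powr ((\<nu> - 2) / 2) * \<beta> powr (\<nu> - 2)"
      using L \<beta> by (simp add: powr_mult powr_half_sqrt[symmetric] powr_powr)
    finally have "\<beta> powr (3 - \<nu>) * e powr (\<nu> - 2)
        \<le> \<beta> powr (3 - \<nu>) * (L powr ((\<nu> - 2) / 2) * \<beta> powr (\<nu> - 2))"
      by (rule mult_left_mono) simp
    also have "\<dots> = L powr ((\<nu> - 2) / 2) * \<beta> powr (3 - \<nu> + (\<nu> - 2))"
      unfolding powr_add by simp
    also have "\<dots> = L powr ((\<nu> - 2) / 2) * \<beta>" using \<beta> by simp
    also have "\<dots> \<le> L powr ((\<nu> - 2) / 2) * D" using \<beta> by (intro mult_left_mono) auto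
    finally have "(\<nu> - 2) / 2 * (\<beta> powr (3 - \<nu>) * e powr (\<nu> - 2))
        \<le> (\<nu> - 2) / 2 * (L powr ((\<nu> - 2) / 2) * D)"
      using 3 by (intro mult_left_mono) auto
    then show ?thesis using 3 by (simp add: delta_def rpow_def algebra_simps diff_divide_distrib)
  qed
qed

text \<open>The denominator in \<open>c1\<close> is \<open>M\<close> times the bound of \<open>delta_le\<close>; for \<open>\<nu> = 3\<close> the factor \<open>1/2\<close> of that bound
  appears as a factor \<open>2\<close> in the numerator.\<close>

lemma c1_le_rate:
  assumes \<nu>: "2 \<le> \<nu>" "\<nu> \<le> 3" and \<beta>: "0 < \<beta>" "\<beta> \<le> D" and e: "0 < e" "e \<le> sqrt L * \<beta>" and L: "0 < L"
    and M: "0 < M" and m: "0 < M * delta \<nu> \<beta> e"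
  shows "c1 D L M \<nu> \<le> rate_lin \<nu> / (M * delta \<nu> \<beta> e)"
proof -
  define K where "K = (if \<nu> = 2 then D else if \<nu> = 3 then sqrt L * D / 2
    else D * (\<nu> / 2 - 1) * L powr ((\<nu> - 2) / 2))"
  have "delta \<nu> \<beta> e \<le> K" unfolding K_def by (rule delta_le[OF \<nu> \<beta> e L])
  then have "M * delta \<nu> \<beta> e \<le> M * K" using M by simp
  then have "rate_lin \<nu> / (M * K) \<le> rate_lin \<nu> / (M * delta \<nu> \<beta> e)"
    using m rate_pos(1)[OF \<nu>] by (intro divide_left_mono) auto
  moreover have "c1 D L M \<nu> \<le> rate_lin \<nu> / (M * K)"
  proof -
    have "2 * (1 - ln 2) / (M * sqrt L * D) = (1 - ln 2) / (M * (sqrt L * D / 2))"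
      by (simp add: field_simps)
    then show ?thesis
      using M \<nu> unfolding c1_def rate_lin_def K_def by (auto simp: ac_simps)
  qed
  ultimately show ?thesis by simp
qed

text \<open>The division by \<open>2\<close> is essential: for \<open>\<nu> = 3\<close> the numerator of \<open>c2\<close> is twice \<open>rate_quad\<close>.\<close>

lemma c2_le_rate:
  assumes \<nu>: "2 \<le> \<nu>" "\<nu> \<le> 3" and e: "0 < e" "e\<^sup>2 \<le> L * D\<^sup>2"
  shows "c2 D L \<nu> / 2 \<le> rate_quad \<nu> / e\<^sup>2"
proof -
  have pos: "0 < e\<^sup>2" "0 < L * D\<^sup>2" using e by (simp_all add: less_le_trans[OF zero_less_power])
  have "- 1 / ((2 - \<nu>) / (4 - \<nu>)) = (4 - \<nu>) / (\<nu> - 2)" if "\<nu> \<noteq> 2"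
    using that \<nu> by (simp add: field_simps)
  then have "c2 D L \<nu> = (if \<nu> = 3 then 2 else 1) * (rate_quad \<nu> / (L * D\<^sup>2))"
    by (simp add: c2_def rate_quad_def)
  moreover have "0 \<le> rate_quad \<nu> / (L * D\<^sup>2)"
    using pos rate_pos(2)[OF \<nu>] by simp
  ultimately have "c2 D L \<nu> \<le> 2 * (rate_quad \<nu> / (L * D\<^sup>2))"
    by (simp only: mult_right_mono split: if_split) simp
  also have "rate_quad \<nu> / (L * D\<^sup>2) \<le> rate_quad \<nu> / e\<^sup>2"
    using pos e(2) rate_pos(2)[OF \<nu>] by (intro divide_left_mono) auto
  finally show ?thesis by linarith
qed

lemma c1_nonneg:
  assumes "2 \<le> \<nu>" "\<nu> \<le> 3" "0 \<le> M" "0 \<le> D" "0 \<le> L"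
  shows "0 \<le> c1 D L M \<nu>"
proof -
  have "ln 2 < (1::real)" using ln_2_less_1 .
  then show ?thesis
    using rate_pos(1)[OF assms(1,2)] assms by (auto simp: c1_def rate_lin_def split: if_splits)
qed

lemma c1_le_half: "c1 D L M \<nu> \<le> 1 / 2"
  by (auto simp only: c1_def min.cobounded1 order_refl split: if_split)

lemma c2_nonneg:
  assumes \<nu>: "2 \<le> \<nu>" "\<nu> \<le> 3" and "0 \<le> L"
  shows "0 \<le> c2 D L \<nu>"
proof -
  have "0 < rate_quad \<nu>" by (rule rate_pos(2)[OF \<nu>])
  moreover have "- 1 / ((2 - \<nu>) / (4 - \<nu>)) = (4 - \<nu>) / (\<nu> - 2)" if "\<nu> \<noteq> 2"
    using that \<nu> by (simp add: field_simps)
  ultimately show ?thesis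
    using assms rate_pos(1)[OF \<nu>] by (auto simp: c2_def rate_quad_def rate_lin_def split: if_splits)
qed

text \<open>Here \<open>r\<close> is the distance to the minimizer, \<open>p\<close> the decrease predicted by the gradient, \<open>G\<close> the
  slope of the step and \<open>d\<close> the actual decrease. In the linear case \<open>h \<le> p\<close> and \<open>r \<le> D\<close> suffice. In the
  quadratic case strong convexity gives \<open>p\<^sup>2 \<ge> 2 \<sigma> h r\<^sup>2\<close>, so the distance cancels.\<close>

lemma contraction_arith:
  fixes c1 c2 W D h p r \<sigma> G d :: real
  assumes r: "0 < r" "r \<le> D" and W: "0 < W" and h: "0 \<le> h" and \<sigma>: "0 \<le> \<sigma>"
    and p: "h + \<sigma> / 2 * r\<^sup>2 \<le> p" and gap: "W * p \<le> 2 * G * r"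
    and c: "0 \<le> c1" "0 \<le> c2" and d: "c1 * G \<le> d \<or> c2 / 2 * G\<^sup>2 \<le> d"
  shows "min (1/2) (min (c1 * W / (2 * D)) (c2 * W\<^sup>2 * \<sigma> / 8)) * h \<le> d"
  using d
proof
  have "0 \<le> \<sigma> / 2 * r\<^sup>2" using \<sigma> by simp
  then have hp: "h \<le> p" using p by linarith
  assume d1: "c1 * G \<le> d"
  have "W * h \<le> W * p" using hp W by simp
  then have *: "W * h \<le> 2 * G * r" using gap by simp
  have "0 \<le> W * h" using W h by simp
  then have "0 \<le> (2 * r) * G" using * by (simp add: mult.commute mult.left_commute)
  then have "0 \<le> G" using r by (simp add: zero_le_mult_iff)
  then have "2 * G * r \<le> 2 * G * D" using r by (intro mult_left_mono) auto
  then have "c1 * (W * h) \<le> c1 * (2 * G * D)" using * c by (intro mult_left_mono) auto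
  then have "c1 * W / (2 * D) * h \<le> c1 * G" using r by (simp add: field_simps)
  then have "c1 * W / (2 * D) * h \<le> d" using d1 by simp
  moreover have "min (1/2) (min (c1 * W / (2 * D)) (c2 * W\<^sup>2 * \<sigma> / 8)) * h \<le> c1 * W / (2 * D) * h"
    by (rule mult_right_mono[OF _ h]) simp
  ultimately show ?thesis by linarith
next
  have "0 \<le> \<sigma> / 2 * r\<^sup>2" using \<sigma> by simp
  then have hp: "h \<le> p" using p by linarith
  assume d2: "c2 / 2 * G\<^sup>2 \<le> d"
  \<comment> \<open>The arithmetic-geometric mean inequality.\<close>
  have "2 * h * \<sigma> * r\<^sup>2 \<le> (h + \<sigma> / 2 * r\<^sup>2)\<^sup>2"
    using zero_le_power2[of "h - \<sigma> / 2 * r\<^sup>2"] by (simp add: power2_eq_square algebra_simps)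
  also have "\<dots> \<le> p\<^sup>2" using p h \<sigma> by (intro power_mono) auto
  finally have "W\<^sup>2 * (2 * h * \<sigma> * r\<^sup>2) \<le> W\<^sup>2 * p\<^sup>2" by (intro mult_left_mono) auto
  also have "W\<^sup>2 * p\<^sup>2 = (W * p)\<^sup>2" by (simp add: power_mult_distrib)
  also have "\<dots> \<le> (2 * G * r)\<^sup>2" using gap W hp h by (intro power_mono) auto
  finally have "(W\<^sup>2 * (2 * h * \<sigma>)) * r\<^sup>2 \<le> (4 * G\<^sup>2) * r\<^sup>2" by (simp add: power2_eq_square ac_simps)
  then have "W\<^sup>2 * (2 * h * \<sigma>) \<le> 4 * G\<^sup>2" using r by simp
  then have "c2 * (W\<^sup>2 * (2 * h * \<sigma>)) \<le> c2 * (4 * G\<^sup>2)" using c by (intro mult_left_mono) auto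
  moreover have "c2 * W\<^sup>2 * \<sigma> / 8 * h = c2 * (W\<^sup>2 * (2 * h * \<sigma>)) / 16" by simp
  moreover have "c2 * (4 * G\<^sup>2) / 16 \<le> c2 / 2 * G\<^sup>2"
    using c(2) by simp
  ultimately have "c2 * W\<^sup>2 * \<sigma> / 8 * h \<le> c2 / 2 * G\<^sup>2" by linarith
  then have "c2 * W\<^sup>2 * \<sigma> / 8 * h \<le> d" using d2 by (rule order_trans)
  moreover have "min (1/2) (min (c1 * W / (2 * D)) (c2 * W\<^sup>2 * \<sigma> / 8)) * h \<le> (c2 * W\<^sup>2 * \<sigma> / 8) * h"
    by (rule mult_right_mono[OF _ h]) simp
  ultimately show ?thesis by linarith
qed

section \<open>The away-step algorithm\<close>

locale asfw =
  fixes f :: "real^'n \<Rightarrow> ereal"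
    and B :: "real^'n^'m" and b :: "real^'m"
    and M \<nu> :: real
    and xstar :: "real^'n"
    and s :: "real^'n \<Rightarrow> real^'n"
    and x :: "nat \<Rightarrow> real^'n" and \<mu> :: "nat \<Rightarrow> real^'n \<Rightarrow> real"
    and u :: "nat \<Rightarrow> real^'n" and \<alpha> :: "nat \<Rightarrow> real"
    and X :: "(real^'n) set"
  defines "X \<equiv> polyhedron_of B b"
  assumes \<nu>: "2 \<le> \<nu>" "\<nu> \<le> 3" and M: "0 \<le> M"
    and f: "f \<in> GSC M \<nu>"
    and X: "compact X"
    and xstar: "is_arg_min f (\<lambda>y. y \<in> X) xstar"
    and cont: "continuous_on (X \<inter> edom f) (hess f)"
    and posdef: "\<forall>y\<in>X \<inter> edom f. \<forall>w. w \<noteq> 0 \<longrightarrow> 0 < (hess f y *v w) \<bullet> w"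
    and lmo: "linear_oracle f X s"
    and alg: "ASFWGSC f M \<nu> X s x \<mu> u \<alpha>"
begin

definition "fwd k \<longleftrightarrow> forward_test f (x k) (s (x k)) (u k)"

definition "dir k = (if fwd k then s (x k) - x k else x k - u k)"

definition "tmax k = (if fwd k then 1 else \<mu> k (u k) / (1 - \<mu> k (u k)))"

text \<open>The weights after a step of length \<open>t\<close>, for an arbitrary \<open>t\<close>: the values at \<open>t = tmax k\<close> show that the
  longest admissible step stays in the polytope.\<close>

definition "weights k t w = (if fwd k then (1 - t) * \<mu> k w + (if w = s (x k) then t else 0)
  else (1 + t) * \<mu> k w - (if w = u k then t else 0))"

definition "feasible k \<longleftrightarrow> x k \<in> edom f \<and> (\<forall>w\<in>vertices X. 0 \<le> \<mu> k w) \<and>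
  (\<Sum>w\<in>vertices X. \<mu> k w) = 1 \<and> x k = (\<Sum>w\<in>vertices X. \<mu> k w *\<^sub>R w)"

lemma step:
  shows u_arg_max: "is_arg_max (\<lambda>w. grad f (x k) \<bullet> w) (\<lambda>w. w \<in> support X (\<mu> k)) (u k)"
    and \<alpha>_arg_min: "is_arg_min (step_model f M \<nu> (x k) (dir k)) (\<lambda>t. t \<in> {0..tmax k}) (\<alpha> k)"
    and x_Suc: "x (Suc k) = x k + \<alpha> k *\<^sub>R dir k"
    and \<mu>_Suc: "w \<in> vertices X \<Longrightarrow> \<mu> (Suc k) w = weights k (\<alpha> k) w"
  using alg unfolding ASFWGSC_def ASFW_step_def Let_def fwd_def dir_def tmax_def weights_def by blast+

lemma pos: "y \<in> X \<inter> edom f \<Longrightarrow> w \<noteq> 0 \<Longrightarrow> 0 < hess_form f y w"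
  using posdef by (simp add: hess_form_def)

lemma finite_V: "finite (vertices X)"
  unfolding X_def by (rule finite_vertices_polyhedron_of)

lemma convex_X: "convex X"
  unfolding X_def by (rule convex_polyhedron_of)

lemma combination_in_X:
  assumes "\<And>w. w \<in> vertices X \<Longrightarrow> 0 \<le> c w" "(\<Sum>w\<in>vertices X. c w) = 1"
  shows "(\<Sum>w\<in>vertices X. c w *\<^sub>R w) \<in> X"
  using assms vertices_subset[of X] by (intro convex_sum finite_V convex_X) auto

lemma feasible_0: "feasible 0"
proof -
  have x0: "x 0 \<in> vertices X" "x 0 \<in> edom f"
    and \<mu>0: "\<And>w. w \<in> vertices X \<Longrightarrow> \<mu> 0 w = (if w = x 0 then 1 else 0)"
    using alg by (auto simp: ASFWGSC_def)
  have "(\<Sum>w\<in>vertices X. \<mu> 0 w) = (\<Sum>w\<in>vertices X. if w = x 0 then 1 else 0)"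
    by (rule sum.cong) (auto simp: \<mu>0)
  moreover have "(\<Sum>w\<in>vertices X. \<mu> 0 w *\<^sub>R w) = (\<Sum>w\<in>vertices X. if w = x 0 then x 0 else 0)"
    by (rule sum.cong) (auto simp: \<mu>0)
  ultimately show ?thesis
    using x0 \<mu>0 finite_V by (simp add: feasible_def)
qed

context
  fixes k assumes feas: "feasible k"
begin

lemma x_in: "x k \<in> X" "x k \<in> edom f"
  using combination_in_X[of "\<mu> k"] feas by (auto simp: feasible_def)

lemma u_in: "u k \<in> vertices X" "0 < \<mu> k (u k)" "u k \<in> X"
  using u_arg_max[of k] vertices_subset[of X] by (auto simp: is_arg_max_def support_def)

lemma u_max: "w \<in> support X (\<mu> k) \<Longrightarrow> grad f (x k) \<bullet> w \<le> grad f (x k) \<bullet> u k"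
  using u_arg_max[of k] by (auto simp: is_arg_max_linorder)

lemma s_in: "s (x k) \<in> vertices X" "s (x k) \<in> X"
  using lmo x_in vertices_subset[of X] by (auto simp: linear_oracle_def)

lemma s_min: "z \<in> X \<Longrightarrow> grad f (x k) \<bullet> s (x k) \<le> grad f (x k) \<bullet> z"
  using lmo x_in by (auto simp: linear_oracle_def is_arg_min_linorder)

lemma \<mu>_le_1: "w \<in> vertices X \<Longrightarrow> \<mu> k w \<le> 1"
  using member_le_sum[of w "vertices X" "\<mu> k"] finite_V feas by (auto simp: feasible_def)

text \<open>If all the weight were on \<open>u k\<close>, the iterate would be \<open>u k\<close> itself, and the test would select a
  forward step.\<close>

lemma away_weight_lt_1:
  assumes "\<not> fwd k"
  shows "\<mu> k (u k) < 1"
proof (rule ccontr)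
  assume "\<not> \<mu> k (u k) < 1"
  then have one: "\<mu> k (u k) = 1" using \<mu>_le_1[OF u_in(1)] by simp
  have "(\<Sum>w\<in>vertices X - {u k}. \<mu> k w) = 0"
    using sum.remove[OF finite_V u_in(1), of "\<mu> k"] one feas by (simp add: feasible_def)
  then have "\<forall>w\<in>vertices X - {u k}. \<mu> k w = 0"
    using feas finite_V by (subst (asm) sum_nonneg_eq_0_iff) (auto simp: feasible_def)
  then have "(\<Sum>w\<in>vertices X. \<mu> k w *\<^sub>R w) = u k"
    using sum.remove[OF finite_V u_in(1), of "\<lambda>w. \<mu> k w *\<^sub>R w"] one by simp
  then have "x k = u k" using feas by (simp add: feasible_def)
  then have "fwd k"
    using s_min[OF x_in(1)] by (simp add: fwd_def forward_test_def inner_diff_right)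
  then show False using assms by simp
qed

lemma tmax_nonneg: "0 \<le> tmax k"
  using away_weight_lt_1 u_in(2) by (auto simp: tmax_def)

lemma weights_nonneg:
  assumes "0 \<le> t" "t \<le> tmax k" "w \<in> vertices X"
  shows "0 \<le> weights k t w"
proof -
  have \<mu>: "0 \<le> \<mu> k w" using feas assms by (simp add: feasible_def)
  show ?thesis
  proof (cases "fwd k \<or> w \<noteq> u k")
    case True
    then show ?thesis using assms \<mu> by (auto simp: weights_def tmax_def)
  next
    case False
    then have "t * (1 - \<mu> k (u k)) \<le> \<mu> k (u k)"
      using assms away_weight_lt_1 by (simp add: tmax_def pos_le_divide_eq)
    then show ?thesis using False by (simp add: weights_def algebra_simps)
  qed
qed

lemma weights_represent:
  shows "(\<Sum>w\<in>vertices X. weights k t w) = 1"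
    and "(\<Sum>w\<in>vertices X. weights k t w *\<^sub>R w) = x k + t *\<^sub>R dir k"
proof -
  have sum1: "(\<Sum>w\<in>vertices X. \<mu> k w) = 1" and repr: "(\<Sum>w\<in>vertices X. \<mu> k w *\<^sub>R w) = x k"
    using feas by (simp_all add: feasible_def)
  have delta: "(\<Sum>w\<in>vertices X. if w = z then t else 0) = t"
    "(\<Sum>w\<in>vertices X. (if w = z then t else 0) *\<^sub>R w) = t *\<^sub>R z" if "z \<in> vertices X" for z
  proof -
    show "(\<Sum>w\<in>vertices X. if w = z then t else 0) = t" using that finite_V by simp
    have "(\<Sum>w\<in>vertices X. (if w = z then t else 0) *\<^sub>R w) = (\<Sum>w\<in>vertices X. if w = z then t *\<^sub>R z else 0)"
      by (rule sum.cong) auto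
    then show "(\<Sum>w\<in>vertices X. (if w = z then t else 0) *\<^sub>R w) = t *\<^sub>R z" using that finite_V by simp
  qed
  have scaled: "(\<Sum>w\<in>vertices X. (c * \<mu> k w) *\<^sub>R w) = c *\<^sub>R x k" for c
    unfolding repr[symmetric] scaleR_sum_right by simp
  show "(\<Sum>w\<in>vertices X. weights k t w) = 1"
  proof (cases "fwd k")
    case True
    then show ?thesis
      by (simp add: weights_def sum.distrib delta[OF s_in(1)] sum1 flip: sum_distrib_left)
  next
    case False
    then show ?thesis
      by (simp add: weights_def sum_subtractf delta[OF u_in(1)] sum1 flip: sum_distrib_left)
  qed
  show "(\<Sum>w\<in>vertices X. weights k t w *\<^sub>R w) = x k + t *\<^sub>R dir k"
  proof (cases "fwd k")
    case True
    then show ?thesis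
      by (simp add: weights_def scaleR_left_distrib sum.distrib delta[OF s_in(1)] scaled dir_def)
         (simp add: algebra_simps)
  next
    case False
    then show ?thesis
      by (simp add: weights_def scaleR_left_diff_distrib sum_subtractf delta[OF u_in(1)] scaled dir_def)
         (simp add: algebra_simps)
  qed
qed

lemma end_in_X: "x k + tmax k *\<^sub>R dir k \<in> X"
  using combination_in_X[of "weights k (tmax k)"] weights_nonneg[OF tmax_nonneg order_refl]
    weights_represent[of "tmax k"] by simp

lemma line_search: "line_search f M \<nu> X (x k) (dir k) (tmax k) (\<alpha> k)"
  proof
  show "is_arg_min (step_model f M \<nu> (x k) (dir k)) (\<lambda>t. t \<in> {0..tmax k}) (\<alpha> k)"
    by (rule \<alpha>_arg_min)
qed (use f \<nu> M convex_X pos x_in tmax_nonneg end_in_X in auto)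

lemma feasible_Suc: "feasible (Suc k)"
proof -
  interpret line_search f M \<nu> X "x k" "dir k" "tmax k" "\<alpha> k" by (rule line_search)
  have "(\<Sum>w\<in>vertices X. \<mu> (Suc k) w) = (\<Sum>w\<in>vertices X. weights k (\<alpha> k) w)"
    "(\<Sum>w\<in>vertices X. \<mu> (Suc k) w *\<^sub>R w) = (\<Sum>w\<in>vertices X. weights k (\<alpha> k) w *\<^sub>R w)"
    by (auto intro!: sum.cong simp: \<mu>_Suc)
  then show ?thesis
    unfolding feasible_def x_Suc
    using weights_represent[of "\<alpha> k"] decrease_nonneg(1) weights_nonneg[OF \<alpha>_range] \<mu>_Suc by simp
qed

lemma descent: "real_part f (x (Suc k)) \<le> real_part f (x k)"
proof -
  interpret line_search f M \<nu> X "x k" "dir k" "tmax k" "\<alpha> k" by (rule line_search)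
  show ?thesis unfolding x_Suc by (rule decrease_nonneg(2))
qed

end

lemma feasible: "feasible k"
  by (induction k) (auto intro: feasible_0 feasible_Suc)

lemma sublevel: "x k \<in> sublevel f X (x 0)"
proof -
  have "real_part f (x k) \<le> real_part f (x 0)"
    by (induction k) (auto intro: order_trans[OF descent[OF feasible]])
  then have "f (x k) \<le> ereal (real_part f (x 0))"
    unfolding GSC_le_ereal_iff[OF f x_in(2)[OF feasible]] .
  then show ?thesis
    unfolding GSC_ereal[OF f x_in(2)[OF feasible], symmetric]
    using x_in[OF feasible, of k] by (simp add: sublevel_def)
qed

lemma xstar_in: "xstar \<in> X" "xstar \<in> edom f" "xstar \<in> sublevel f X (x 0)"
  and xstar_le: "y \<in> X \<Longrightarrow> f xstar \<le> f y"
proof -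
  show le: "f xstar \<le> f y" if "y \<in> X" for y
    using xstar that by (auto simp: is_arg_min_linorder)
  show "xstar \<in> X" using xstar by (simp add: is_arg_min_def)
  have "f xstar \<le> f (x 0)" by (rule le[OF x_in(1)[OF feasible]])
  then show "xstar \<in> edom f" "xstar \<in> sublevel f X (x 0)"
    using x_in(2)[OF feasible, of 0] \<open>xstar \<in> X\<close> by (auto simp: sublevel_def edom_def)
qed

definition "gap k = real_part f (x k) - real_part f xstar"

lemma gap_nonneg: "0 \<le> gap k"
proof -
  have "f xstar \<le> ereal (real_part f (x k))"
    using xstar_le[OF x_in(1)[OF feasible]] unfolding GSC_ereal[OF f x_in(2)[OF feasible], symmetric] .
  then show ?thesis
    unfolding GSC_le_ereal_iff[OF f xstar_in(2)] by (simp add: gap_def)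
qed

lemma gap_Suc_le: "gap (Suc k) \<le> gap k"
  using descent[OF feasible, of k] by (simp add: gap_def)

lemma f_minus_fstar: "f (x k) - f xstar = ereal (gap k)"
  using GSC_ereal[OF f x_in(2)[OF feasible], of k] GSC_ereal[OF f xstar_in(2)]
  by (metis gap_def ereal_minus(1))

definition "D = diameter X"

definition "L = L_grad f X (x 0)"

definition "\<sigma> = sigma_min f X (x 0)"

definition "\<Omega> = Omega_geom B b / real (card (vertices X))"

definition "\<theta> = min (1/2) (min (c1 D L M \<nu> * \<Omega> / (2 * D)) (c2 D L \<nu> * \<Omega>\<^sup>2 * \<sigma> / 8))"

lemma dist_le_D: "y \<in> X \<Longrightarrow> z \<in> X \<Longrightarrow> norm (y - z) \<le> D"
  unfolding D_def using diameter_bounded_bound[OF compact_imp_bounded[OF X]] by (simp add: dist_norm)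

lemmas form_bounds = hess_form_bounds[OF f X x_in(2)[OF feasible] cont pos]

lemma \<sigma>_nonneg: "0 \<le> \<sigma>"
  unfolding \<sigma>_def by (rule form_bounds(3)[OF _ _ sublevel[of 0]]) auto

lemma L_pos: "v \<noteq> 0 \<Longrightarrow> 0 < L" for v :: "real^'n"
proof -
  assume v: "v \<noteq> 0"
  have "0 < hess_form f (x 0) v" using pos[of "x 0" v] x_in[OF feasible, of 0] v by simp
  also have "\<dots> \<le> L * (norm v)\<^sup>2"
    unfolding L_def by (rule form_bounds(2)[OF _ _ sublevel[of 0]]) auto
  finally show ?thesis using v by (simp add: zero_less_mult_iff)
qed

lemma forward_away_gap:
  assumes "y \<in> X" "y \<noteq> x k"
  shows "0 < \<Omega>"
    and "\<Omega> * (grad f (x k) \<bullet> (x k - y)) \<le> (grad f (x k) \<bullet> (u k - s (x k))) * norm (x k - y)"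
proof -
  have us: "grad f (x k) \<bullet> s (x k) \<le> grad f (x k) \<bullet> u k"
    by (rule s_min[OF feasible u_in(3)[OF feasible]])
  have feas: "\<And>w. w \<in> vertices X \<Longrightarrow> 0 \<le> \<mu> k w" "(\<Sum>w\<in>vertices X. \<mu> k w) = 1"
    "x k = (\<Sum>w\<in>vertices X. \<mu> k w *\<^sub>R w)"
    using feasible[of k] by (auto simp: feasible_def)
  note * = pairwise_gap_bound[of B b "\<mu> k" "x k" y "grad f (x k)" "u k" "s (x k)", folded X_def,
      OF compact_imp_bounded[OF X] feas assms u_max[OF feasible] s_min[OF feasible] us]
  have "0 < card (vertices X)"
    using u_in(1)[OF feasible, of k] finite_V by (auto simp: card_gt_0_iff)
  then show "0 < \<Omega>" using *(1) by (simp add: \<Omega>_def)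
  show "\<Omega> * (grad f (x k) \<bullet> (x k - y)) \<le> (grad f (x k) \<bullet> (u k - s (x k))) * norm (x k - y)"
    unfolding \<Omega>_def by (rule *(2))
qed

text \<open>If the polytope is a single point, the sets defining \<open>Omega_geom\<close> can be empty and its value
  unspecified; then \<open>D = 0\<close>, and division by zero makes \<open>\<theta>\<close> vanish.\<close>

lemma \<theta>_range: "0 \<le> \<theta>" "\<theta> \<le> 1 / 2"
proof -
  show "\<theta> \<le> 1 / 2" by (simp add: \<theta>_def)
  show "0 \<le> \<theta>"
  proof (cases "X = {x 0}")
    case True
    then have "D = 0" by (simp add: D_def)
    then show ?thesis by (simp add: \<theta>_def c2_def)
  next
    case False
    then obtain y where y: "y \<in> X" "y \<noteq> x 0" using x_in(1)[OF feasible, of 0] by blast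
    have "0 \<le> D" using dist_le_D[OF y(1) y(1)] by simp
    moreover have "0 \<le> L" using L_pos[of "y - x 0"] y by simp
    ultimately show ?thesis
      using c1_nonneg[OF \<nu> M, of D L] c2_nonneg[OF \<nu>, of L D] forward_away_gap(1)[OF y] \<sigma>_nonneg
      by (simp add: \<theta>_def)
  qed
qed

text \<open>The negation characterizes drop steps.\<close>

definition "good k \<longleftrightarrow> fwd k \<or> \<alpha> k < tmax k"

lemma dir_le_D: "norm (dir k) \<le> D"
  using dist_le_D x_in(1)[OF feasible] s_in(2)[OF feasible] u_in(3)[OF feasible]
  by (simp add: dir_def)

text \<open>The test compares two quantities whose sum is \<open>- (grad f (x k) \<bullet> (u k - s (x k)))\<close>, so the slope of the
  chosen direction is at least half of the pairwise gap. If the slope is not positive, the current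
  iterate is already optimal.\<close>

lemma contraction:
  assumes good: "good k"
  shows "gap (Suc k) \<le> (1 - \<theta>) * gap k"
proof (cases "xstar = x k")
  case True
  then have "gap k = 0" unfolding gap_def by simp
  then show ?thesis using gap_Suc_le[of k] by simp
next
  case False
  let ?g = "grad f (x k)"
  interpret ls: line_search f M \<nu> X "x k" "dir k" "tmax k" "\<alpha> k" by (rule line_search[OF feasible])
  define d where "d = real_part f (x k) - real_part f (x (Suc k))"
  define p where "p = ?g \<bullet> (x k - xstar)"
  define r where "r = norm (x k - xstar)"
  have r: "0 < r" "r \<le> D"
    using False dist_le_D[OF x_in(1)[OF feasible] xstar_in(1)] by (auto simp: r_def)
  have D: "0 < D" using r by simp
  have L: "0 < L" using L_pos[of "x k - xstar"] False by simp
  note geo = forward_away_gap[OF xstar_in(1) False]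
  have two: "?g \<bullet> (u k - s (x k)) \<le> 2 * ls.slope"
    unfolding ls.slope_def unfolding dir_def fwd_def forward_test_def by (auto simp: inner_diff_right)
  have gap: "\<Omega> * p \<le> 2 * ls.slope * r"
    using geo(2)[folded p_def r_def] mult_right_mono[OF two, of r] r(1) by linarith
  have p: "gap k + \<sigma> / 2 * r\<^sup>2 \<le> p"
    using strong_convexity_on_sublevel[OF f X convex_X x_in(2)[OF feasible] cont pos sublevel xstar_in(3), of k]
    by (simp add: gap_def p_def r_def \<sigma>_def inner_diff_right norm_minus_commute)
  have "\<theta> * gap k \<le> d"
  proof (cases "0 < ls.slope")
    case False
    then have "2 * ls.slope * r \<le> 0" using r by (simp add: mult_le_0_iff)
    with gap have "\<Omega> * p \<le> 0" by (rule order_trans)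
    then have "p \<le> 0" using geo(1) by (simp add: mult_le_0_iff)
    moreover have "0 \<le> \<sigma> / 2 * r\<^sup>2" using \<sigma>_nonneg by simp
    ultimately have "gap k = 0" using p gap_nonneg[of k] by linarith
    then show ?thesis using descent[OF feasible, of k] by (simp add: d_def)
  next
    case True
    have v: "dir k \<noteq> 0" using True by (auto simp: ls.slope_def)
    have e: "0 < ls.curv" by (rule ls.curv_pos[OF v])
    have "ls.curv\<^sup>2 = hess_form f (x k) (dir k)"
      unfolding ls.curv_def
      by (rule local_norm_sq, rule less_imp_le, rule pos) (use x_in[OF feasible] v in auto)
    also have "\<dots> \<le> L * (norm (dir k))\<^sup>2"
      unfolding L_def by (rule form_bounds(2)[OF _ _ sublevel]) auto
    finally have e2: "ls.curv\<^sup>2 \<le> L * (norm (dir k))\<^sup>2" .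
    then have "sqrt (ls.curv\<^sup>2) \<le> sqrt (L * (norm (dir k))\<^sup>2)" by (rule real_sqrt_le_mono)
    then have e1: "ls.curv \<le> sqrt L * norm (dir k)"
      using e by (simp add: real_sqrt_mult)
    have "L * (norm (dir k))\<^sup>2 \<le> L * D\<^sup>2"
      using L dir_le_D by (intro mult_left_mono power_mono) auto
    then have e3: "ls.curv\<^sup>2 \<le> L * D\<^sup>2" using e2 by simp
    have full: "\<alpha> k < tmax k \<or> 1 \<le> tmax k"
      using good by (auto simp: good_def tmax_def)
    have "c1 D L M \<nu> * ls.slope \<le> d \<or> c2 D L \<nu> / 2 * ls.slope\<^sup>2 \<le> d"
      using ls.decrease[OF True full, folded x_Suc, folded d_def]
    proof (elim disjE conjE)
      assume sc: "0 < ls.sc_scale" and le: "rate_lin \<nu> * ls.slope / ls.sc_scale \<le> d"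
      have "M \<noteq> 0" using sc unfolding ls.sc_scale_def by auto
      then have "0 < M" using M by simp
      then have "c1 D L M \<nu> \<le> rate_lin \<nu> / ls.sc_scale"
        using sc unfolding ls.sc_scale_def
        by (intro c1_le_rate \<nu> dir_le_D e e1 L) (use v \<open>0 < M\<close> in auto)
      then have "c1 D L M \<nu> * ls.slope \<le> rate_lin \<nu> / ls.sc_scale * ls.slope"
        using True by (intro mult_right_mono) auto
      also have "\<dots> = rate_lin \<nu> * ls.slope / ls.sc_scale" by simp
      also note le
      finally show ?thesis by blast
    next
      assume le: "rate_quad \<nu> * ls.slope\<^sup>2 / ls.curv\<^sup>2 \<le> d"
      have "c2 D L \<nu> / 2 * ls.slope\<^sup>2 \<le> rate_quad \<nu> / ls.curv\<^sup>2 * ls.slope\<^sup>2"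
        by (rule mult_right_mono[OF c2_le_rate[OF \<nu> e e3]]) simp
      also have "\<dots> = rate_quad \<nu> * ls.slope\<^sup>2 / ls.curv\<^sup>2" by simp
      also note le
      finally show ?thesis by blast
    next
      assume le: "ls.slope / 2 \<le> d"
      have "c1 D L M \<nu> * ls.slope \<le> 1 / 2 * ls.slope"
        using True by (intro mult_right_mono c1_le_half) auto
      also have "\<dots> = ls.slope / 2" by simp
      also note le
      finally show ?thesis by blast
    qed
    then show ?thesis
      unfolding \<theta>_def
      by (intro contraction_arith[OF r geo(1) gap_nonneg \<sigma>_nonneg p gap])
         (use c1_nonneg[OF \<nu> M] c2_nonneg[OF \<nu>] D L in auto)
  qed
  moreover have "gap (Suc k) = gap k - d" by (simp add: gap_def d_def)
  ultimately show ?thesis by (simp add: algebra_simps)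
qed

definition "goods k = card {i. i < k \<and> good i}"

lemma goods_simps: "goods 0 = 0" "goods (Suc k) = (if good k then Suc (goods k) else goods k)"
proof -
  show "goods 0 = 0" by (simp add: goods_def)
  have "{i. i < Suc k \<and> good i} = (if good k then insert k {i. i < k \<and> good i} else {i. i < k \<and> good i})"
    by (auto simp: less_Suc_eq)
  then show "goods (Suc k) = (if good k then Suc (goods k) else goods k)"
    by (simp add: goods_def)
qed

lemma finite_support: "finite (support X c)"
  using finite_V by (simp add: support_def)

text \<open>A forward step can add only the vertex \<open>s (x k)\<close>, an away step adds none, and a drop step has the
  length at which the weight of \<open>u k\<close> reaches zero.\<close>

lemma card_support_Suc:
  shows "good k \<Longrightarrow> card (support X (\<mu> (Suc k))) \<le> Suc (card (support X (\<mu> k)))"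
    and "\<not> good k \<Longrightarrow> Suc (card (support X (\<mu> (Suc k)))) \<le> card (support X (\<mu> k))"
proof -
  interpret ls: line_search f M \<nu> X "x k" "dir k" "tmax k" "\<alpha> k" by (rule line_search[OF feasible])
  have nonneg: "\<And>w. w \<in> vertices X \<Longrightarrow> 0 \<le> \<mu> k w" using feasible[of k] by (simp add: feasible_def)
  have away: "support X (\<mu> (Suc k)) \<subseteq> support X (\<mu> k)" if "\<not> fwd k"
  proof
    fix w assume "w \<in> support X (\<mu> (Suc k))"
    then have w: "w \<in> vertices X" "0 < weights k (\<alpha> k) w" by (auto simp: support_def \<mu>_Suc)
    then have "\<mu> k w \<noteq> 0" using that ls.\<alpha>_range by (auto simp: weights_def split: if_splits)
    then show "w \<in> support X (\<mu> k)" using nonneg[OF w(1)] w(1) by (simp add: support_def)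
  qed
  show "card (support X (\<mu> (Suc k))) \<le> Suc (card (support X (\<mu> k)))"
  proof (cases "fwd k")
    case True
    have "support X (\<mu> (Suc k)) \<subseteq> insert (s (x k)) (support X (\<mu> k))"
    proof
      fix w assume "w \<in> support X (\<mu> (Suc k))"
      then have w: "w \<in> vertices X" "0 < weights k (\<alpha> k) w" by (auto simp: support_def \<mu>_Suc)
      then have "w = s (x k) \<or> \<mu> k w \<noteq> 0" using True by (auto simp: weights_def)
      then show "w \<in> insert (s (x k)) (support X (\<mu> k))"
        using nonneg[OF w(1)] w(1) by (auto simp: support_def)
    qed
    then have "card (support X (\<mu> (Suc k))) \<le> card (insert (s (x k)) (support X (\<mu> k)))"
      by (intro card_mono) (auto simp: finite_support)
    also have "\<dots> \<le> Suc (card (support X (\<mu> k)))"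
      by (rule card_insert_le_m1) auto
    finally show ?thesis .
  next
    case False
    then show ?thesis using card_mono[OF finite_support away] by (simp add: le_SucI)
  qed
  show "Suc (card (support X (\<mu> (Suc k)))) \<le> card (support X (\<mu> k))" if "\<not> good k"
  proof -
    have nf: "\<not> fwd k" and full: "\<alpha> k = tmax k"
      using that ls.\<alpha>_range by (auto simp: good_def)
    have "\<alpha> k * (1 - \<mu> k (u k)) = \<mu> k (u k)"
      using full nf away_weight_lt_1[OF feasible nf] by (simp add: tmax_def)
    then have "weights k (\<alpha> k) (u k) = 0"
      using nf by (simp add: weights_def algebra_simps)
    then have "u k \<notin> support X (\<mu> (Suc k))"
      using u_in(1)[OF feasible] by (simp add: support_def \<mu>_Suc)
    moreover have "u k \<in> support X (\<mu> k)"
      using u_in[OF feasible, of k] by (simp add: support_def)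
    ultimately have "support X (\<mu> (Suc k)) \<subset> support X (\<mu> k)" using away[OF nf] by blast
    then show ?thesis using psubset_card_mono[OF finite_support] by (simp add: Suc_le_eq)
  qed
qed

text \<open>The size of the support, which starts at \<open>1\<close> and stays positive, pays for the drop steps.\<close>

lemma half_of_steps_good: "k \<le> 2 * goods k"
proof -
  have "card (support X (\<mu> k)) + k \<le> 1 + 2 * goods k"
  proof (induction k)
    case 0
    have "support X (\<mu> 0) \<subseteq> {x 0}"
      using alg by (auto simp: support_def ASFWGSC_def split: if_splits)
    then have "card (support X (\<mu> 0)) \<le> 1" using card_mono[of "{x 0}"] by simp
    then show ?case by simp
  next
    case (Suc k)
    then show ?case using card_support_Suc[of k] by (cases "good k") (auto simp: goods_simps)
  qed
  moreover have "u k \<in> support X (\<mu> k)"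
    using u_in[OF feasible, of k] by (simp add: support_def)
  then have "1 \<le> card (support X (\<mu> k))"
    using finite_support by (metis One_nat_def Suc_leI card_gt_0_iff empty_iff)
  ultimately show ?thesis by simp
qed

lemma gap_goods: "gap k \<le> (1 - \<theta>) ^ goods k * gap 0"
proof (induction k)
  case (Suc k)
  show ?case
  proof (cases "good k")
    case True
    have "gap (Suc k) \<le> (1 - \<theta>) * gap k" by (rule contraction[OF True])
    also have "\<dots> \<le> (1 - \<theta>) * ((1 - \<theta>) ^ goods k * gap 0)"
      using Suc \<theta>_range by (intro mult_left_mono) auto
    finally show ?thesis using True by (simp add: goods_simps)
  next
    case False
    then show ?thesis using Suc gap_Suc_le[of k] by (simp add: goods_simps)
  qed
qed (simp add: goods_simps)

lemma gap_rate: "gap k \<le> (1 - \<theta>) powr (real k / 2) * gap 0"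
proof -
  have "(1 - \<theta>) ^ goods k = (1 - \<theta>) powr real (goods k)"
    using \<theta>_range by (simp add: powr_realpow)
  also have "\<dots> \<le> (1 - \<theta>) powr (real k / 2)"
    using \<theta>_range half_of_steps_good[of k] by (intro powr_mono') auto
  finally show ?thesis
    using gap_goods[of k] gap_nonneg[of 0] by (meson mult_right_mono order_trans)
qed

lemma rate_exp: "(1 - \<theta>) powr (real k / 2) * gap 0 \<le> exp (- \<theta> * (real k / 2)) * gap 0"
proof -
  have "(1 - \<theta>) powr (real k / 2) \<le> exp (- \<theta>) powr (real k / 2)"
    using \<theta>_range exp_ge_add_one_self[of "- \<theta>"] by (intro powr_mono2) auto
  also have "\<dots> = exp (- \<theta> * (real k / 2))"
    by (simp add: powr_def)
  finally show ?thesis using gap_nonneg by (rule mult_right_mono)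
qed

end

section \<open>The convergence rate\<close>

theorem theorem5p7:
  fixes f :: "real^'n \<Rightarrow> ereal"
    and B :: "real^'n^'m" and b :: "real^'m"
    and M \<nu> :: real
    and xstar :: "real^'n"
    and s :: "real^'n \<Rightarrow> real^'n"
    and x :: "nat \<Rightarrow> real^'n" and \<mu> :: "nat \<Rightarrow> real^'n \<Rightarrow> real"
    and u :: "nat \<Rightarrow> real^'n" and \<alpha> :: "nat \<Rightarrow> real"
  assumes "2 \<le> \<nu>" and "\<nu> \<le> 3" and "0 \<le> M"
    and "f \<in> GSC M \<nu>"
    and "compact (polyhedron_of B b)"
    and "is_arg_min f (\<lambda>y. y \<in> polyhedron_of B b) xstar"
    and "continuous_on (polyhedron_of B b \<inter> edom f) (hess f)"
    and "\<forall>y\<in>polyhedron_of B b \<inter> edom f. \<forall>w. w \<noteq> 0 \<longrightarrow> 0 < (hess f y *v w) \<bullet> w"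
    and "linear_oracle f (polyhedron_of B b) s"
    and "ASFWGSC f M \<nu> (polyhedron_of B b) s x \<mu> u \<alpha>"
  shows
    "let X = polyhedron_of B b;
         D = diameter X;
         L = L_grad f X (x 0);
         \<Omega> = Omega_geom B b / real (card (vertices X));
         \<theta> = min (1/2) (min (c1 D L M \<nu> * \<Omega> / (2 * D))
                            (c2 D L \<nu> * \<Omega>\<^sup>2 * sigma_min f X (x 0) / 8));
         h = (\<lambda>k. f (x k) - f xstar)
     in \<forall>k. h k \<le> ereal ((1 - \<theta>) powr (real k / 2)) * h 0 \<and>
            ereal ((1 - \<theta>) powr (real k / 2)) * h 0 \<le> ereal (exp (- \<theta> * (real k / 2))) * h 0"
proof -
  interpret asfw f B b M \<nu> xstar s x \<mu> u \<alpha> "polyhedron_of B b"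
    by unfold_locales (use assms in auto)
  have "f (x k) - f xstar \<le> ereal ((1 - \<theta>) powr (real k / 2)) * (f (x 0) - f xstar) \<and>
      ereal ((1 - \<theta>) powr (real k / 2)) * (f (x 0) - f xstar)
        \<le> ereal (exp (- \<theta> * (real k / 2))) * (f (x 0) - f xstar)" for k
    unfolding f_minus_fstar using gap_rate[of k] rate_exp[of k] by simp
  then show ?thesis
    unfolding \<theta>_def D_def L_def \<sigma>_def \<Omega>_def Let_def by blast
qed

end
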